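(* Let $D\subset\mathbb{H}$ be a definite quaternion division algebra over $\mathbb{Q}$ (with $D\otimes\mathbb{R}\cong\mathbb{H}$), $\mathcal{O}\subset D$ a maximal order, and $L\subset D$ a left ideal of $\mathcal{O}$ which is a full-rank lattice in $\mathbb{H}$, with $\mathbb{Z}$-basis $\lambda={}^t(\lambda_1,\dots,\lambda_4)$ such that $\det\Lambda>0$. For $a\in\mathcal{O}$ let $U_a\in M_4(\mathbb{Z})$ be defined by $a\lambda=U_a\lambda$. Let $\eta={}^t(\eta_1,\dots,\eta_4)$ with $\eta_h=\zeta(q+\lambda_h)-\zeta(q)$. Then for every $a\in\mathcal{O}$, $${}^t\widehat\lambda\cdot U_a\cdot\eta=2\pi^2\,\bar a .$$ (For $a=1$ this is ${}^t\widehat\lambda\cdot\eta=2\pi^2$.)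
   Context: $q=t+e_1x_1+e_2x_2+e_3x_3$ ($e_0=1$). $\lambda_h=\sum_{\alpha=0}^3\lambda_h^\alpha e_\alpha$, $\Lambda=(\lambda_h^\alpha)$ (rows $h=1..4$, columns $\alpha=0..3$); $\widehat\lambda_h=\sum_\alpha c_{h\alpha}e_\alpha$ where $c_{h\alpha}$ is the cofactor of the entry $\lambda_h^\alpha$ in $\Lambda$, i.e. $\widehat\lambda=\det(\Lambda)\,{}^t(\Lambda^{-1})\,{}^t(1,e_1,e_2,e_3)$. $G(q)=\bar q/|q|^4$, $G_{(j)}=\partial G/\partial x_j$, $z_j(q)=te_j-x_j$. The Weierstrass $\zeta$-function of $L$ is $\zeta(q)=G(q)+\sum_{\lambda\in L\setminus\{0\}}\big(G(q+\lambda)-G(\lambda)+\sum_{j=1}^3G_{(j)}(\lambda)z_j(q)\big)$ on $\mathbb{H}\setminus L$; it is left- and right-regular, has simple poles on $L$ with residue $1$, and $\zeta(q+\lambda_h)-\zeta(q)$ is independent of $q$. Products ${}^t\widehat\lambda\cdot U_a\cdot\eta=\sum_{i,j}\widehat\lambda_i(U_a)_{ij}\eta_j$. *)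

theory Defs
  imports "HOL-Analysis.Analysis"
begin

text \<open>Quaternions are modelled as real^4; component 0 is the real part t,
components 1,2,3 are x_1,x_2,x_3, i.e. q = t + e_1 x_1 + e_2 x_2 + e_3 x_3
with e_alpha = axis alpha 1.\<close>

definition qmk :: "real \<Rightarrow> real \<Rightarrow> real \<Rightarrow> real \<Rightarrow> real^4" where
  "qmk a b c d = (\<chi> i. if i = 0 then a else if i = 1 then b else if i = 2 then c else d)"

definition qone :: "real^4" where "qone = qmk 1 0 0 0"

definition qmul :: "real^4 \<Rightarrow> real^4 \<Rightarrow> real^4" where
  "qmul p q = qmk
     (p$0*q$0 - p$1*q$1 - p$2*q$2 - p$3*q$3)
     (p$0*q$1 + p$1*q$0 + p$2*q$3 - p$3*q$2)
     (p$0*q$2 - p$1*q$3 + p$2*q$0 + p$3*q$1)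
     (p$0*q$3 + p$1*q$2 - p$2*q$1 + p$3*q$0)"

definition qcnj :: "real^4 \<Rightarrow> real^4" where
  "qcnj q = qmk (q$0) (- q$1) (- q$2) (- q$3)"

definition Gfun :: "real^4 \<Rightarrow> real^4" where
  "Gfun q = (1 / norm q ^ 4) *\<^sub>R qcnj q"

definition Gpart :: "4 \<Rightarrow> real^4 \<Rightarrow> real^4" where
  "Gpart j q = vector_derivative (\<lambda>s. Gfun (q + s *\<^sub>R axis j 1)) (at 0)"

definition zfun :: "4 \<Rightarrow> real^4 \<Rightarrow> real^4" where
  "zfun j q = (q$0) *\<^sub>R axis j 1 - qmk (q$j) 0 0 0"

definition wzeta :: "(real^4) set \<Rightarrow> real^4 \<Rightarrow> real^4" where
  "wzeta L q = Gfun q +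
     (\<Sum>\<^sub>\<infinity> l\<in>L - {0}. Gfun (q + l) - Gfun l
        + (\<Sum>j\<in>{1,2,3::4}. qmul (Gpart j l) (zfun j q)))"

definition zspan :: "real^4^4 \<Rightarrow> (real^4) set" where
  "zspan b = range (\<lambda>n::4 \<Rightarrow> int. \<Sum>h\<in>UNIV. of_int (n h) *\<^sub>R b$h)"

definition qspan :: "real^4^4 \<Rightarrow> (real^4) set" where
  "qspan b = {\<Sum>h\<in>UNIV. r h *\<^sub>R b$h | r. \<forall>h. r h \<in> \<rat>}"

text \<open>A Q-subalgebra D of H which is a division algebra with D \<otimes> R = H:
  D is the Q-span of an R-basis of H, contains 1, is closed under + and *,
  and nonzero elements are invertible in D.\<close>
definition quat_division_algebra :: "(real^4) set \<Rightarrow> bool" where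
  "quat_division_algebra D \<longleftrightarrow>
     (\<exists>b. det b \<noteq> 0 \<and> D = qspan b) \<and> qone \<in> D \<and>
     (\<forall>x\<in>D. \<forall>y\<in>D. x + y \<in> D \<and> qmul x y \<in> D) \<and>
     (\<forall>x\<in>D. x \<noteq> 0 \<longrightarrow> (\<exists>y\<in>D. qmul x y = qone \<and> qmul y x = qone))"

definition order_of :: "(real^4) set \<Rightarrow> (real^4) set \<Rightarrow> bool" where
  "order_of D Ord \<longleftrightarrow> Ord \<subseteq> D \<and> qone \<in> Ord \<and> (\<forall>x\<in>Ord. \<forall>y\<in>Ord. qmul x y \<in> Ord) \<and>
     (\<exists>b. det b \<noteq> 0 \<and> Ord = zspan b)"

definition maximal_order :: "(real^4) set \<Rightarrow> (real^4) set \<Rightarrow> bool" where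
  "maximal_order D Ord \<longleftrightarrow> order_of D Ord \<and>
     (\<forall>Ord'. order_of D Ord' \<and> Ord \<subseteq> Ord' \<longrightarrow> Ord' = Ord)"

end

theory Submission
  imports Defs "HOL-Probability.Distributions"
begin

text \<open>
  Left multiplication by \<open>qcnj a\<close> is adjoint to left multiplication by \<open>a\<close>, so \<open>U\<close> acts on the
  vector of cofactor rows as left multiplication by \<open>qcnj a\<close>, and everything reduces to \<open>a = 1\<close>,
  which holds for every lattice \<open>L\<close>.

  For \<open>a = 1\<close> the linear correction terms cancel by regularity of \<open>Gfun\<close>, and the claim becomes
  \<open>\<Sum>l\<in>L. w (q + l) = 2 \<pi>\<^sup>2\<close> with \<open>w x = \<Sum>h. c_h (G (x + \<lambda>_h) - G x)\<close>, where \<open>c_h\<close> are the cofactor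
  rows. Instead of Stokes' theorem on a period cell, insert a radial cutoff \<open>\<phi> (x / R)\<close> with \<open>\<phi> 0 = 1\<close> and
  sum by parts, which moves the differences onto \<open>\<phi>\<close>; up to an error that vanishes as \<open>R\<close> tends to infinity
  this is \<open>- det \<Lambda> R\<^sup>-\<^sup>1 \<Sum>l. (\<Sum>\<alpha>. e_\<alpha> \<partial>_\<alpha> \<phi>) ((q + l) / R) G (q + l)\<close>. For
  \<open>\<phi> x = (1 + |x|\<^sup>2) exp (-|x|\<^sup>2)\<close> the summand with its factor \<open>- R\<^sup>-\<^sup>1\<close> is \<open>2 R\<^sup>-\<^sup>4 exp (-|q + l|\<^sup>2 / R\<^sup>2)\<close>, whose sum times
  \<open>det \<Lambda>\<close> is a Riemann sum for twice the Gaussian integral \<open>\<pi>\<^sup>2\<close> over four-space.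
\<close>

subsection \<open>Quaternion algebra\<close>

text \<open>In the type \<open>4\<close> the numeral 4 equals 0, so the cases 1, 2, 3, 4 become the
  component indices 0, 1, 2, 3.\<close>

lemma exhaust_4_0: "i = 0 \<or> i = 1 \<or> i = 2 \<or> i = (3::4)"
  using exhaust_4[of i] by auto

lemma UNIV_4_0: "UNIV = {0, 1, 2, 3::4}"
  using exhaust_4_0 by auto

lemma forall_4_0: "(\<forall>i::4. P i) \<longleftrightarrow> P 0 \<and> P 1 \<and> P 2 \<and> P 3"
  by (metis exhaust_4_0)

lemma sum_4_0: "sum f (UNIV::4 set) = f 0 + f 1 + f 2 + f 3"
  unfolding UNIV_4_0 by (simp add: ac_simps)

lemma qmk_nth [simp]: "qmk a b c d $ 0 = a" "qmk a b c d $ 1 = b" "qmk a b c d $ 2 = c" "qmk a b c d $ 3 = d"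
  by (simp_all add: qmk_def)

lemmas quat_eq_iff = vec_eq_iff[where 'a=real and 'b=4, unfolded forall_4_0]

lemma axis_4_nth [simp]:
  "axis (0::4) x $ 0 = x" "axis (1::4) x $ 1 = x" "axis (2::4) x $ 2 = x" "axis (3::4) x $ 3 = x"
  "axis (0::4) x $ 1 = 0" "axis (0::4) x $ 2 = 0" "axis (0::4) x $ 3 = 0"
  "axis (1::4) x $ 0 = 0" "axis (1::4) x $ 2 = 0" "axis (1::4) x $ 3 = 0"
  "axis (2::4) x $ 0 = 0" "axis (2::4) x $ 1 = 0" "axis (2::4) x $ 3 = 0"
  "axis (3::4) x $ 0 = 0" "axis (3::4) x $ 1 = 0" "axis (3::4) x $ 2 = 0"
  by (simp_all add: axis_def)

lemma qmul_nth [simp]: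
  "qmul p q $ 0 = p$0*q$0 - p$1*q$1 - p$2*q$2 - p$3*q$3"
  "qmul p q $ 1 = p$0*q$1 + p$1*q$0 + p$2*q$3 - p$3*q$2"
  "qmul p q $ 2 = p$0*q$2 - p$1*q$3 + p$2*q$0 + p$3*q$1"
  "qmul p q $ 3 = p$0*q$3 + p$1*q$2 - p$2*q$1 + p$3*q$0"
  by (simp_all add: qmul_def)

lemma qcnj_nth [simp]:
  "qcnj q $ 0 = q$0" "qcnj q $ 1 = - (q$1)" "qcnj q $ 2 = - (q$2)" "qcnj q $ 3 = - (q$3)"
  by (simp_all add: qcnj_def)

lemma qone_nth [simp]: "qone $ 0 = 1" "qone $ 1 = 0" "qone $ 2 = 0" "qone $ 3 = 0"
  by (simp_all add: qone_def)

lemma inner_quat: "(x :: real^4) \<bullet> y = x$0*y$0 + x$1*y$1 + x$2*y$2 + x$3*y$3"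
  by (simp add: inner_vec_def sum_4_0)

lemma norm_quat_power2: "(norm (x :: real^4))\<^sup>2 = x$0*x$0 + x$1*x$1 + x$2*x$2 + x$3*x$3"
  by (simp add: power2_norm_eq_inner inner_quat)

interpretation qmul: bounded_bilinear qmul
proof -
  have "bilinear qmul"
    by (auto intro!: linearI simp: bilinear_def quat_eq_iff algebra_simps)
  then show "bounded_bilinear qmul"
    by (rule bilinear_conv_bounded_bilinear[THEN iffD1])
qed

lemma bounded_linear_qcnj: "bounded_linear qcnj"
proof -
  have "linear qcnj"
    by (auto intro!: linearI simp: quat_eq_iff)
  then show "bounded_linear qcnj"
    by (rule linear_conv_bounded_linear[THEN iffD1])
qed

lemmas qcnj_add = linear_add[OF bounded_linear.linear[OF bounded_linear_qcnj]]
lemmas qcnj_scaleR = linear_scale[OF bounded_linear.linear[OF bounded_linear_qcnj]]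

lemma qmul_assoc: "qmul (qmul p q) r = qmul p (qmul q r)"
  by (simp add: quat_eq_iff algebra_simps)

lemma qmul_qone_right [simp]: "qmul p qone = p"
  by (simp add: quat_eq_iff)

lemma qmul_qcnj: "qmul q (qcnj q) = (norm q)\<^sup>2 *\<^sub>R qone"
  by (simp add: quat_eq_iff norm_quat_power2 algebra_simps)

lemma norm_qcnj [simp]: "norm (qcnj q) = norm q"
proof -
  have "(norm (qcnj q))\<^sup>2 = (norm q)\<^sup>2"
    by (simp add: norm_quat_power2)
  then show ?thesis by simp
qed

subsection \<open>The kernel and its derivative\<close>

text \<open>Closed form of the total derivative of \<open>Gfun\<close> at a nonzero point x in
  direction v. Division by zero makes it 0 at x = 0.\<close>

definition dG :: "real^4 \<Rightarrow> real^4 \<Rightarrow> real^4" where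
  "dG x v = (1 / norm x ^ 4) *\<^sub>R qcnj v - (4 * (x \<bullet> v) / norm x ^ 6) *\<^sub>R qcnj x"

lemma Gfun_0 [simp]: "Gfun 0 = 0"
  by (simp add: Gfun_def)

lemma dG_0 [simp]: "dG 0 v = 0"
  by (simp add: dG_def)

lemma linear_dG: "linear (dG x)"
  by (auto intro!: linearI simp: dG_def qcnj_add qcnj_scaleR inner_add_right algebra_simps
      add_divide_distrib)

lemma norm_Gfun: "norm (Gfun x) = 1 / norm x ^ 3"
  by (cases "x = 0") (simp_all add: Gfun_def field_simps eval_nat_numeral)

lemma Gpart_eq:
  assumes "x \<noteq> 0"
  shows "Gpart j x = dG x (axis j 1)"
proof -
  let ?e = "axis j 1 :: real^4"
  have nz: "x \<bullet> x \<noteq> 0" using assms by simp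
  \<comment> \<open>The fourth power of the norm is written as a squared inner product, a polynomial
    in s, so the norm itself is never differentiated.\<close>
  have "((\<lambda>s. 1 / ((x + s *\<^sub>R ?e) \<bullet> (x + s *\<^sub>R ?e))\<^sup>2)
      has_real_derivative (- 4 * (x \<bullet> ?e) / (x \<bullet> x) ^ 3)) (at 0)"
    using nz
    apply (auto intro!: derivative_eq_intros simp: inner_add_left inner_add_right inner_commute)
    apply (auto simp: field_simps eval_nat_numeral)
    done
  moreover have "(x \<bullet> x) ^ 3 = norm x ^ 6"
    by (simp add: power2_norm_eq_inner[symmetric] power_mult[symmetric])
  ultimately have r: "((\<lambda>s. 1 / (norm (x + s *\<^sub>R ?e) ^ 2)\<^sup>2)
      has_real_derivative (- 4 * (x \<bullet> ?e) / norm x ^ 6)) (at 0)"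
    unfolding power2_norm_eq_inner by metis
  have e: "(norm y ^ 2)\<^sup>2 = norm y ^ 4" for y :: "real^4"
    by (simp add: power_mult[symmetric])
  have "((\<lambda>s. Gfun (x + s *\<^sub>R ?e)) has_vector_derivative dG x ?e) (at 0)"
    unfolding Gfun_def dG_def
    apply (rule has_vector_derivative_eq_rhs)
     apply (rule has_vector_derivative_scaleR)
      apply (rule r[unfolded e])
     apply (rule bounded_linear.has_vector_derivative[OF bounded_linear_qcnj])
     apply (auto intro!: derivative_eq_intros)
    done
  then show ?thesis
    unfolding Gpart_def by (rule vector_derivative_at)
qed

text \<open>By right regularity of \<open>Gfun\<close>, the products of \<open>Gpart j l\<close>
  with e_j over the imaginary directions add up to minus the derivative in the real direction. The
  three corrections in \<open>wzeta\<close> therefore form minus a single total derivative.\<close>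

lemma sum_Gpart_zfun:
  assumes "l \<noteq> 0"
  shows "(\<Sum>j\<in>{1,2,3}. qmul (Gpart j l) (zfun j q)) = - dG l q"
proof -
  \<comment> \<open>Expressing the inverse fourth power through the inverse sixth power turns the
    claim into a polynomial identity in the coordinates.\<close>
  have "norm l ^ 2 * (1 / norm l ^ 6) = 1 / norm l ^ 4"
    using assms by (simp add: field_simps eval_nat_numeral)
  then obtain A B where AB: "1 / norm l ^ 6 = B" "1 / norm l ^ 4 = A" 
    "A = (l$0*l$0 + l$1*l$1 + l$2*l$2 + l$3*l$3) * B"
    unfolding norm_quat_power2 by metis
  have dG': "dG l v = A *\<^sub>R qcnj v - (4 * (l \<bullet> v) * B) *\<^sub>R qcnj l" for v
    unfolding dG_def by (simp flip: AB(1,2))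
  show ?thesis
    using assms by (simp add: Gpart_eq dG' zfun_def quat_eq_iff inner_quat AB(3) algebra_simps)
qed

text \<open>The Cauchy-Riemann-Fueter equation, that is, left regularity of
  \<open>Gfun\<close>.\<close>

lemma dG_regular: "(\<Sum>\<alpha>\<in>UNIV. qmul (axis \<alpha> 1) (dG x (axis \<alpha> 1))) = 0"
proof (cases "x = 0")
  case False
  then have "norm x ^ 2 * (1 / norm x ^ 6) = 1 / norm x ^ 4"
    by (simp add: field_simps eval_nat_numeral)
  then obtain A B where AB: "1 / norm x ^ 6 = B" "1 / norm x ^ 4 = A" 
    "A = (x$0*x$0 + x$1*x$1 + x$2*x$2 + x$3*x$3) * B"
    unfolding norm_quat_power2 by metis
  have dG': "dG x v = A *\<^sub>R qcnj v - (4 * (x \<bullet> v) * B) *\<^sub>R qcnj x" for v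
    unfolding dG_def by (simp flip: AB(1,2))
  show ?thesis
    by (simp add: dG' sum_4_0 quat_eq_iff inner_quat AB(3) algebra_simps)
qed (simp add: qmul.zero_right)

text \<open>Allows estimates at the translated point to be stated in terms of \<open>norm x\<close>
  alone.\<close>

lemma norm_comparable_translate:
  fixes x v :: "'a::real_normed_vector"
  assumes "\<delta> > 0" "\<delta> \<le> norm (x + v)"
  shows "norm x \<le> (1 + norm v / \<delta>) * norm (x + v)"
proof -
  have "norm v \<le> norm v / \<delta> * norm (x + v)"
    using mult_right_mono[OF assms(2), of "norm v"] assms(1) by (simp add: field_simps)
  moreover have "norm x \<le> norm (x + v) + norm v"
    by (metis add_diff_cancel_right' norm_triangle_ineq4)
  ultimately show ?thesis by (simp add: algebra_simps)
qed

text \<open>\<open>Gfun\<close> is homogeneous of degree -3, so its second-order remainder has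
  degree -5, which is summable over a lattice in four-space. The segment from x to x + v may meet
  the pole, so the proof expands exactly in the squared norms r and s instead of integrating along
  it.\<close>

lemma Gfun_taylor:
  fixes v :: "real^4"
  assumes "\<delta> > 0"
  shows "\<exists>C. \<forall>x. \<delta> \<le> norm x \<longrightarrow> \<delta> \<le> norm (x + v) \<longrightarrow>
           norm (Gfun (x + v) - Gfun x - dG x v) \<le> C / norm x ^ 5"
proof -
  define M where "M = norm v / \<delta>"
  define c where "c = 1 / (1 + M)"
  have M: "M \<ge> 0" using assms by (simp add: M_def)
  then have c: "c > 0" by (simp add: c_def)
  define C where "C = (norm v)\<^sup>2 * ((2 + M)\<^sup>2 * (1 + M) * (1 / c ^ 4 + 2 / c\<^sup>2) + 2 * (2 + M) + 2)"
  have "norm (Gfun (x + v) - Gfun x - dG x v) \<le> C / norm x ^ 5"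
    if x: "\<delta> \<le> norm x" and xv: "\<delta> \<le> norm (x + v)" for x
  proof -
    define a where "a = norm x"
    define r where "r = a\<^sup>2"
    define s where "s = (norm (x + v))\<^sup>2"
    define d where "d = s - r"
    have a: "a > 0" unfolding a_def using x assms by linarith
    have r: "r > 0" using a by (simp add: r_def)
    have va: "norm v \<le> M * a"
      using mult_right_mono[OF x, of "norm v"] assms by (simp add: M_def a_def field_simps)
    have "a \<le> (1 + M) * norm (x + v)"
      unfolding a_def M_def by (rule norm_comparable_translate[OF assms xv])
    then have ca: "c * a \<le> norm (x + v)"
      using M by (simp add: c_def field_simps)
    have cs: "c\<^sup>2 * r \<le> s"
      unfolding r_def s_def power_mult_distrib[symmetric] using ca c a
      by (intro power_mono) auto
    have s: "s > 0" using c r cs by (smt (verit) mult_pos_pos zero_less_power)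
    have deq: "d = 2 * (x \<bullet> v) + (norm v)\<^sup>2"
      by (simp add: d_def s_def r_def a_def power2_norm_eq_inner inner_add_left inner_add_right inner_commute)
    have "\<bar>x \<bullet> v\<bar> \<le> a * norm v"
      unfolding a_def by (rule Cauchy_Schwarz_ineq2)
    moreover have "(norm v)\<^sup>2 \<le> M * a * norm v"
      unfolding power2_eq_square using va by (intro mult_right_mono) auto
    moreover have "0 \<le> (norm v)\<^sup>2"
      by simp
    ultimately have "\<bar>d\<bar> \<le> 2 * (a * norm v) + M * a * norm v"
      unfolding deq by linarith
    then have d: "\<bar>d\<bar> \<le> (2 + M) * norm v * a"
      by (simp add: algebra_simps)
    \<comment> \<open>\<open>\<rho>\<close> is the remainder of the first-order expansion of the
      inverse square at r, evaluated at s. Exact algebra then exhibits the factor d squared.\<close>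
    define \<rho> where "\<rho> = 1 / s\<^sup>2 - 1 / r\<^sup>2 + 2 * d / r ^ 3"
    have \<rho>: "\<rho> = d\<^sup>2 * (1 / (r\<^sup>2 * s\<^sup>2) + 2 / (r ^ 3 * s))"
      using r s unfolding \<rho>_def d_def by (simp add: field_simps eval_nat_numeral)
    \<comment> \<open>Replacing four times the inner product of x and v by
      \<open>2 * d - 2 * (norm v)\<^sup>2\<close> in \<open>dG\<close> leaves three terms, each of
      order -5 in \<open>norm x\<close>.\<close>
    have eq: "Gfun (x + v) - Gfun x - dG x v =
        \<rho> *\<^sub>R qcnj (x + v) - (2 * d / r ^ 3) *\<^sub>R qcnj v - (2 * (norm v)\<^sup>2 / r ^ 3) *\<^sub>R qcnj x"
    proof -
      have e: "norm (x + v) ^ 4 = s\<^sup>2" "norm x ^ 4 = r\<^sup>2" "norm x ^ 6 = r ^ 3"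
        by (simp_all add: s_def r_def a_def power_mult[symmetric])
      have xv: "4 * (x \<bullet> v) / r ^ 3 = 2 * d / r ^ 3 - 2 * (norm v)\<^sup>2 / r ^ 3"
        by (simp add: deq diff_divide_distrib[symmetric])
      show ?thesis
        unfolding Gfun_def dG_def e xv \<rho>_def qcnj_add by (simp add: algebra_simps)
    qed
    have "d\<^sup>2 \<le> ((2 + M) * norm v * a)\<^sup>2"
      using d by (metis abs_ge_zero power2_abs power_mono)
    then have d2: "d\<^sup>2 \<le> (2 + M)\<^sup>2 * (norm v)\<^sup>2 * r"
      by (simp add: power_mult_distrib r_def)
    have "1 / (r\<^sup>2 * s\<^sup>2) \<le> 1 / (r\<^sup>2 * (c\<^sup>2 * r)\<^sup>2)"
      using r s c cs by (intro divide_left_mono mult_left_mono power_mono mult_pos_pos) auto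
    moreover have "2 / (r ^ 3 * s) \<le> 2 / (r ^ 3 * (c\<^sup>2 * r))"
      using r s c cs by (intro divide_left_mono mult_left_mono power_mono mult_pos_pos) auto
    moreover have "1 / (r\<^sup>2 * (c\<^sup>2 * r)\<^sup>2) + 2 / (r ^ 3 * (c\<^sup>2 * r)) = (1 / c ^ 4 + 2 / c\<^sup>2) / r ^ 4"
      using r c by (simp add: field_simps eval_nat_numeral)
    ultimately have "1 / (r\<^sup>2 * s\<^sup>2) + 2 / (r ^ 3 * s) \<le> (1 / c ^ 4 + 2 / c\<^sup>2) / r ^ 4"
      by linarith
    then have "\<rho> \<le> (2 + M)\<^sup>2 * (norm v)\<^sup>2 * r * ((1 / c ^ 4 + 2 / c\<^sup>2) / r ^ 4)"
      unfolding \<rho> using d2 r s by (intro mult_mono) auto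
    moreover have "\<rho> \<ge> 0"
      unfolding \<rho> using r s by (intro mult_nonneg_nonneg add_nonneg_nonneg) auto
    moreover have "norm (x + v) \<le> (1 + M) * a"
      using norm_triangle_ineq[of x v] va by (simp add: a_def algebra_simps)
    ultimately have "\<rho> * norm (x + v) \<le> (2 + M)\<^sup>2 * (norm v)\<^sup>2 * r * ((1 / c ^ 4 + 2 / c\<^sup>2) / r ^ 4) * ((1 + M) * a)"
      by (intro mult_mono) auto
    moreover have "norm (\<rho> *\<^sub>R qcnj (x + v)) = \<rho> * norm (x + v)"
      using \<open>\<rho> \<ge> 0\<close> by simp
    ultimately have "norm (\<rho> *\<^sub>R qcnj (x + v)) \<le> (2 + M)\<^sup>2 * (norm v)\<^sup>2 * r * ((1 / c ^ 4 + 2 / c\<^sup>2) / r ^ 4) * ((1 + M) * a)"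
      by (simp only:)
    also have "\<dots> = (norm v)\<^sup>2 * ((2 + M)\<^sup>2 * (1 + M) * (1 / c ^ 4 + 2 / c\<^sup>2)) * (r * a / r ^ 4)"
      by (simp add: mult_ac)
    also have "r * a / r ^ 4 = 1 / a ^ 5"
      using a by (simp add: r_def field_simps eval_nat_numeral)
    finally have 1: "norm (\<rho> *\<^sub>R qcnj (x + v)) \<le> (norm v)\<^sup>2 * ((2 + M)\<^sup>2 * (1 + M) * (1 / c ^ 4 + 2 / c\<^sup>2)) * (1 / a ^ 5)" .
    have "norm ((2 * d / r ^ 3) *\<^sub>R qcnj v) = 2 * \<bar>d\<bar> / r ^ 3 * norm v"
      using r by (simp add: abs_mult)
    also have "\<dots> \<le> 2 * ((2 + M) * norm v * a) / r ^ 3 * norm v"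
      using r d by (intro mult_right_mono divide_right_mono) auto
    also have "\<dots> = (norm v)\<^sup>2 * (2 * (2 + M)) * (1 / a ^ 5)"
      using a by (simp add: r_def field_simps eval_nat_numeral)
    finally have 2: "norm ((2 * d / r ^ 3) *\<^sub>R qcnj v) \<le> (norm v)\<^sup>2 * (2 * (2 + M)) * (1 / a ^ 5)" .
    have 3: "norm ((2 * (norm v)\<^sup>2 / r ^ 3) *\<^sub>R qcnj x) = (norm v)\<^sup>2 * 2 * (1 / a ^ 5)"
      using a by (simp add: r_def a_def[symmetric] field_simps eval_nat_numeral)
    have "norm (Gfun (x + v) - Gfun x - dG x v) \<le> norm (\<rho> *\<^sub>R qcnj (x + v)) + norm ((2 * d / r ^ 3) *\<^sub>R qcnj v) + norm ((2 * (norm v)\<^sup>2 / r ^ 3) *\<^sub>R qcnj x)"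
      unfolding eq by (meson add_mono norm_triangle_ineq4 order_refl order_trans)
    also have "\<dots> \<le> C * (1 / a ^ 5)"
      using 1 2 3 unfolding C_def ring_distribs by linarith
    finally show ?thesis by (simp add: a_def)
  qed
  then show ?thesis by blast
qed

subsection \<open>Lattice sums\<close>

text \<open>Dominated convergence for the counting measure. The same domination supplies the
  integrability needed to translate between the two notions of infinite sum.\<close>

lemma infsum_tannery:
  fixes f :: "nat \<Rightarrow> 'a \<Rightarrow> 'b::{banach,second_countable_topology}"
  assumes bound: "\<And>k x. x \<in> A \<Longrightarrow> norm (f k x) \<le> g x" and g: "g summable_on A"
    and lim: "\<And>x. x \<in> A \<Longrightarrow> (\<lambda>k. f k x) \<longlonglongrightarrow> h x"
  shows "(\<lambda>k. infsum (f k) A) \<longlonglongrightarrow> infsum h A"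
proof -
  have gint: "integrable (count_space A) g"
    using g summable_on_iff_abs_summable_on_real[of g A] abs_summable_equivalent[of g A]
    by (simp add: abs_summable_on_def)
  have ae: "AE x in count_space A. (\<lambda>k. f k x) \<longlonglongrightarrow> h x"
    "\<And>k. AE x in count_space A. norm (f k x) \<le> g x"
    using lim bound by (auto simp: AE_count_space)
  note dom = gint ae
  have "(\<lambda>k. infsetsum (f k) A) \<longlonglongrightarrow> infsetsum h A"
    unfolding infsetsum_def by (rule integral_dominated_convergence[OF _ _ dom]) auto
  moreover have "infsetsum (f k) A = infsum (f k) A" for k
    using integrable_dominated_convergence2[OF _ _ dom]
    by (intro infsetsum_infsum) (simp add: abs_summable_on_def)
  moreover have "infsetsum h A = infsum h A"
    using integrable_dominated_convergence[OF _ _ dom]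
    by (intro infsetsum_infsum) (simp add: abs_summable_on_def)
  ultimately show ?thesis by simp
qed

section \<open>Integer coordinates and separation of the lattice\<close>

definition ivec :: "int^'n \<Rightarrow> real^'n" where
  "ivec n = (\<chi> h. of_int (n$h))"

lemma ivec_nth [simp]: "ivec n $ h = of_int (n$h)"
  by (simp add: ivec_def)

lemma inj_ivec: "inj ivec"
  by (auto simp: inj_def vec_eq_iff)

lemma zspan_eq: "zspan b = range (\<lambda>n. ivec n v* b)"
proof -
  have eq: "(\<Sum>h\<in>UNIV. of_int (n$h) *\<^sub>R b$h) = ivec n v* b" for n
    by (simp add: vector_matrix_mult_def vec_eq_iff mult.commute)
  have "\<exists>m. n = ($) m" for n :: "4 \<Rightarrow> int"
    by (rule exI[of _ "\<chi> h. n h"]) auto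
  then have "range (($) :: int^4 \<Rightarrow> 4 \<Rightarrow> int) = UNIV"
    by blast
  then have "zspan b = range ((\<lambda>n. \<Sum>h\<in>UNIV. of_int (n h) *\<^sub>R b$h) \<circ> ($))"
    unfolding zspan_def image_comp[symmetric] by simp
  then have "zspan b = range (\<lambda>m :: int^4. \<Sum>h\<in>UNIV. of_int (m$h) *\<^sub>R b$h)"
    by (simp add: o_def)
  then show ?thesis by (simp only: eq)
qed

lemma linear_vector_matrix_mult: "linear (\<lambda>v. v v* (b :: real^'n^'m))"
  by (auto intro!: linearI simp: vec_eq_iff vector_matrix_mult_def sum_distrib_left sum.distrib algebra_simps)

lemma inj_vector_matrix_mult: 
  fixes b :: "real^'n^'n"
  assumes "det b \<noteq> 0"
  shows "inj (\<lambda>v. v v* b)"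
proof -
  have "(\<lambda>v. v v* b) = (*v) (transpose b)" by auto
  moreover have "invertible (transpose b)"
    using assms by (simp add: invertible_det_nz)
  ultimately show ?thesis
    using inj_matrix_vector_mult by metis
qed

lemma zspan_0: "0 \<in> zspan b"
proof -
  have "ivec 0 v* b = 0" by (simp add: vec_eq_iff vector_matrix_mult_def)
  then show ?thesis unfolding zspan_eq by (metis rangeI)
qed

lemma zspan_add: "x \<in> zspan b \<Longrightarrow> y \<in> zspan b \<Longrightarrow> x + y \<in> zspan b"
proof -
  have "ivec m v* b + ivec n v* b = ivec (m + n) v* b" for m n
    by (simp add: vec_eq_iff vector_matrix_mult_def algebra_simps sum.distrib)
  then show "x \<in> zspan b \<Longrightarrow> y \<in> zspan b \<Longrightarrow> x + y \<in> zspan b"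
    unfolding zspan_eq by fastforce
qed

lemma zspan_uminus: "x \<in> zspan b \<Longrightarrow> - x \<in> zspan b"
proof -
  have "- (ivec m v* b) = ivec (- m) v* b" for m
    by (simp add: vec_eq_iff vector_matrix_mult_def sum_negf)
  then show "x \<in> zspan b \<Longrightarrow> - x \<in> zspan b"
    unfolding zspan_eq by fastforce
qed

lemma zspan_row: "b $ h \<in> zspan b"
proof -
  have "ivec (axis h 1) v* b = b $ h"
    by (simp add: vec_eq_iff vector_matrix_mult_def axis_def if_distrib if_distribR sum.delta cong: if_cong)
  then show ?thesis unfolding zspan_eq by (metis rangeI)
qed

lemma zspan_translate_bij: "\<mu> \<in> zspan b \<Longrightarrow> bij_betw (\<lambda>l. l + \<mu>) (zspan b) (zspan b)"
  by (rule bij_betw_byWitness[where f' = "\<lambda>l. l - \<mu>"])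
    (auto intro: zspan_add zspan_add[of _ _ "- \<mu>", simplified] zspan_uminus)

lemma finite_bounded_ivec: "finite {n. norm (ivec n) \<le> N}"
proof -
  have "vec_nth ` {n. norm (ivec n) \<le> N} \<subseteq> PiE UNIV (\<lambda>_. {- \<lceil>N\<rceil>..\<lceil>N\<rceil>})"
  proof (clarsimp simp: PiE_UNIV_domain)
    fix n :: "int^'n" and h assume "norm (ivec n) \<le> N"
    then have "\<bar>of_int (n$h)\<bar> \<le> N"
      using component_le_norm_cart[of "ivec n" h] by simp
    then show "- \<lceil>N\<rceil> \<le> n $ h \<and> n $ h \<le> \<lceil>N\<rceil>" by linarith
  qed
  then have "finite (vec_nth ` {n. norm (ivec n) \<le> N})"
    by (rule finite_subset) (auto intro: finite_PiE)
  then show ?thesis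
    by (rule finite_imageD) (auto simp: inj_on_def vec_nth_inject)
qed

text \<open>For large coordinate vectors the invertibility of b outweighs the fixed shift q; the
  finitely many others contribute a positive minimum. Only the vanishing point is excluded, so q may
  itself be a lattice point, in particular 0.\<close>

lemma lattice_norm_lower_bound:
  fixes b :: "real^'n^'n"
  assumes "det b \<noteq> 0"
  obtains c where "c > 0" "\<And>n. q + ivec n v* b \<noteq> 0 \<Longrightarrow> c * (1 + norm (ivec n)) \<le> norm (q + ivec n v* b)"
proof -
  obtain B where B: "B > 0" "\<And>v. B * norm v \<le> norm (v v* b)"
    using linear_inj_bounded_below_pos[OF linear_vector_matrix_mult inj_vector_matrix_mult[OF assms]]
    by blast
  \<comment> \<open>Beyond N the coordinate norm exceeds 1 and \<open>2 * norm q\<close> is below B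
    times that norm. Absorbing q and the summand 1 leads to the factor 1/4 in
    \<open>far\<close>.\<close>
  define N where "N = max 1 (2 * norm q / B)"
  have far: "B / 4 * (1 + norm (ivec n)) \<le> norm (q + ivec n v* b)" if "norm (ivec n) > N" for n
  proof -
    have "norm (ivec n) > 1" "2 * norm q < B * norm (ivec n)"
      using that B(1) unfolding N_def by (auto simp: field_simps)
    moreover have "B * norm (ivec n) \<le> norm (q + ivec n v* b) + norm q"
      using B(2)[of "ivec n"] norm_triangle_ineq4[of "q + ivec n v* b" q] by simp
    moreover have "B * 1 \<le> B * norm (ivec n)"
      using calculation(1) B(1) by (intro mult_left_mono) auto
    ultimately have "B + B * norm (ivec n) \<le> 4 * norm (q + ivec n v* b)"
      by linarith
    then show ?thesis by (simp add: field_simps)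
  qed
  define S where "S = {n. norm (ivec n) \<le> N \<and> q + ivec n v* b \<noteq> 0}"
  have "finite S"
    unfolding S_def by (rule finite_subset[OF _ finite_bounded_ivec[of N]]) auto
  define c where "c = Min (insert (B / 4) ((\<lambda>n. norm (q + ivec n v* b) / (1 + norm (ivec n))) ` S))"
  have "c > 0"
    unfolding c_def using \<open>finite S\<close> B(1)
    by (subst Min_gr_iff) (auto simp: S_def add_pos_nonneg intro!: divide_pos_pos)
  moreover have "c * (1 + norm (ivec n)) \<le> norm (q + ivec n v* b)" if "q + ivec n v* b \<noteq> 0" for n
  proof (cases "norm (ivec n) > N")
    case True
    have "c \<le> B / 4" unfolding c_def using \<open>finite S\<close> by (intro Min_le) auto
    then have "c * (1 + norm (ivec n)) \<le> B / 4 * (1 + norm (ivec n))"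
      by (intro mult_right_mono) auto
    then show ?thesis using far[OF True] by linarith
  next
    case False
    then have "n \<in> S" using that by (simp add: S_def)
    then have "c \<le> norm (q + ivec n v* b) / (1 + norm (ivec n))"
      unfolding c_def using \<open>finite S\<close> by (intro Min_le) auto
    then show ?thesis
      by (subst (asm) pos_le_divide_eq) (auto simp: add_pos_nonneg)
  qed
  ultimately show ?thesis by (rule that)
qed

lemma lattice_separated:
  assumes "det b \<noteq> 0"
  obtains c where "c > 0" "\<And>l. l \<in> zspan b \<Longrightarrow> q + l \<noteq> 0 \<Longrightarrow> c \<le> norm (q + l)"
proof -
  obtain c where c: "c > 0"
    "\<And>n. q + ivec n v* b \<noteq> 0 \<Longrightarrow> c * (1 + norm (ivec n)) \<le> norm (q + ivec n v* b)"
    using lattice_norm_lower_bound[OF assms] by blast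
  have "c \<le> norm (q + l)" if l: "l \<in> zspan b" and nz: "q + l \<noteq> 0" for l
  proof -
    obtain n where n: "l = ivec n v* b"
      using l unfolding zspan_eq by blast
    have "c * 1 \<le> c * (1 + norm (ivec n))"
      using c(1) by (intro mult_left_mono) auto
    then show ?thesis
      using c(2)[of n] nz unfolding n by linarith
  qed
  with c(1) show ?thesis by (rule that)
qed

section \<open>Convergence of lattice sums of degree -5\<close>

lemma summable_on_int_powr:
  assumes "s < - 1"
  shows "(\<lambda>k::int. (1 + \<bar>of_int k\<bar>) powr s :: real) summable_on UNIV"
proof -
  have nat: "(\<lambda>n::nat. (1 + real n) powr s) summable_on UNIV"
    using assms summable_Suc_iff[of "\<lambda>n. real n powr s"] summable_real_powr_iff[of s]
    by (subst summable_on_UNIV_nonneg_real_iff) (auto simp: add.commute)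
  have "(\<lambda>k::int. (1 + \<bar>of_int k\<bar>) powr s :: real) summable_on range int"
    using nat by (subst summable_on_reindex) (auto simp: o_def inj_on_def)
  moreover have "(\<lambda>k::int. (1 + \<bar>of_int k\<bar>) powr s :: real) summable_on range (\<lambda>n. - int n)"
    using nat by (subst summable_on_reindex) (auto simp: o_def inj_on_def)
  ultimately have "(\<lambda>k::int. (1 + \<bar>of_int k\<bar>) powr s :: real) summable_on (range int \<union> range (\<lambda>n. - int n))"
    by (rule summable_on_union)
  moreover have "range int \<union> range (\<lambda>n. - int n) = UNIV"
    by (auto simp: image_iff) (metis int_cases2)
  ultimately show ?thesis by simp
qed

text \<open>The weight is dominated by a product of one-dimensional weights, each with exponent $5/4 > 1$.\<close>
lemma summable_on_ivec:
  "(\<lambda>n :: int^4. 1 / (1 + norm (ivec n)) ^ 5) summable_on UNIV"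
proof -
  define w where "w k = (1 + \<bar>real_of_int k\<bar>) powr (- 5 / 4)" for k
  have "w summable_on UNIV"
    unfolding w_def by (rule summable_on_int_powr) simp
  then have "Infinite_Set_Sum.abs_summable_on w UNIV"
    using summable_on_iff_abs_summable_on_real abs_summable_equivalent by blast
  then have "Infinite_Set_Sum.abs_summable_on (\<lambda>n :: 4 \<Rightarrow> int. \<Prod>h\<in>UNIV. w (n h)) (PiE UNIV (\<lambda>_. UNIV))"
    by (intro abs_summable_on_prod_PiE) auto
  moreover have "PiE UNIV (\<lambda>_. UNIV) = (UNIV :: (4 \<Rightarrow> int) set)"
    by (auto simp: PiE_UNIV_domain)
  ultimately have prod: "(\<lambda>n :: 4 \<Rightarrow> int. \<Prod>h\<in>UNIV. w (n h)) summable_on UNIV"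
    using abs_summable_equivalent abs_summable_summable by metis
  have "bij_betw vec_nth (UNIV :: (int^4) set) UNIV"
    by (rule bij_betw_byWitness[where f' = vec_lambda]) auto
  then have prod': "(\<lambda>n :: int^4. \<Prod>h\<in>UNIV. w (n $ h)) summable_on UNIV"
    using prod summable_on_reindex_bij_betw by fastforce
  show ?thesis
  proof (rule summable_on_comparison_test[OF prod'])
    fix n :: "int^4"
    have pos: "1 + norm (ivec n) > 0" by (simp add: add_pos_nonneg)
    have "(1 + norm (ivec n)) powr (- 5 / 4) \<le> w (n $ h)" for h
      unfolding w_def using component_le_norm_cart[of "ivec n" h] pos
      by (intro powr_mono2') auto
    then have "(\<Prod>h\<in>(UNIV::4 set). (1 + norm (ivec n)) powr (- 5 / 4)) \<le> (\<Prod>h\<in>UNIV. w (n $ h))"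
      by (intro prod_mono) auto
    also have "(\<Prod>h\<in>(UNIV::4 set). (1 + norm (ivec n)) powr (- 5 / 4)) = (1 + norm (ivec n)) powr (- 5)"
      using pos by (subst prod_constant, subst powr_power) auto
    also have "\<dots> = 1 / (1 + norm (ivec n)) ^ 5"
      using pos powr_realpow[OF pos, of 5] by (simp add: powr_minus_divide)
    finally show "1 / (1 + norm (ivec n)) ^ 5 \<le> (\<Prod>h\<in>UNIV. w (n $ h))" .
  qed simp
qed

text \<open>A possible term with \<open>q + l = 0\<close> has the junk value \<open>1 / 0 = 0\<close>.\<close>
lemma summable_on_zspan:
  assumes "det b \<noteq> 0"
  shows "(\<lambda>l. 1 / norm (q + l) ^ 5) summable_on zspan b"
proof -
  obtain c where c: "c > 0"
    "\<And>n. q + ivec n v* b \<noteq> 0 \<Longrightarrow> c * (1 + norm (ivec n)) \<le> norm (q + ivec n v* b)"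
    using lattice_norm_lower_bound[OF assms] by blast
  have "(\<lambda>n. 1 / norm (q + ivec n v* b) ^ 5) summable_on UNIV"
  proof (rule summable_on_comparison_test)
    show "(\<lambda>n :: int^4. 1 / c ^ 5 * (1 / (1 + norm (ivec n)) ^ 5)) summable_on UNIV"
      by (intro summable_on_cmult_right summable_on_ivec)
    fix n :: "int^4"
    show "1 / norm (q + ivec n v* b) ^ 5 \<le> 1 / c ^ 5 * (1 / (1 + norm (ivec n)) ^ 5)"
    proof (cases "q + ivec n v* b = 0")
      case False
      have p: "c * (1 + norm (ivec n)) > 0" using c(1) by (simp add: add_pos_nonneg)
      then have "1 / norm (q + ivec n v* b) ^ 5 \<le> 1 / (c * (1 + norm (ivec n))) ^ 5"
        using c(2)[OF False] False by (intro divide_left_mono power_mono) auto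
      then show ?thesis by (simp add: power_mult_distrib)
    qed (use c in auto)
  qed simp
  moreover have "inj (\<lambda>n. ivec n v* b)"
    using inj_compose[OF inj_vector_matrix_mult[OF assms] inj_ivec] by (simp add: o_def)
  ultimately show ?thesis
    unfolding zspan_eq by (subst summable_on_reindex) (auto simp: o_def)
qed

subsection \<open>Gaussian sums over lattices\<close>

text \<open>The integrand factors over the coordinates, and each factor contributes the square root
  of pi.\<close>

lemma has_bochner_integral_gaussian:
  "has_bochner_integral lborel (\<lambda>x :: 'a::euclidean_space. exp (- (norm x)\<^sup>2)) (sqrt pi ^ DIM('a))"
proof (rule has_bochner_integral_nn_integral)
  have "has_bochner_integral lborel (\<lambda>x :: real. exp (- x\<^sup>2)) (sqrt pi)"
    using has_bochner_integral_even_function[OF gaussian_moment_0] by simp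
  then have one: "(\<integral>\<^sup>+x. ennreal (exp (- x\<^sup>2)) \<partial>lborel) = ennreal (sqrt pi)"
    by (simp add: has_bochner_integral_iff nn_integral_eq_integral)
  have prod: "exp (- (norm x)\<^sup>2) = (\<Prod>b\<in>Basis. exp (- (x \<bullet> b)\<^sup>2))" for x :: 'a
  proof -
    have "- (norm x)\<^sup>2 = (\<Sum>b\<in>Basis. - (x \<bullet> b)\<^sup>2)"
      unfolding power2_norm_eq_inner by (subst euclidean_inner) (simp add: power2_eq_square sum_negf)
    then show ?thesis by (simp add: exp_sum)
  qed
  have "(\<integral>\<^sup>+x. ennreal (exp (- (norm x)\<^sup>2)) \<partial>(lborel :: 'a measure))
      = (\<integral>\<^sup>+x. (\<Prod>b\<in>Basis. ennreal (exp (- (x \<bullet> b)\<^sup>2))) \<partial>(lborel :: 'a measure))"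
    unfolding prod by (simp add: prod_ennreal)
  also have "\<dots> = (\<Prod>b\<in>(Basis::'a set). (\<integral>\<^sup>+x. ennreal (exp (- x\<^sup>2)) \<partial>lborel))"
    by (rule nn_integral_lborel_prod) auto
  also have "\<dots> = ennreal (sqrt pi ^ DIM('a))"
    by (simp add: one ennreal_power)
  finally show "(\<integral>\<^sup>+x. ennreal (exp (- (norm x)\<^sup>2)) \<partial>(lborel :: 'a measure)) = ennreal (sqrt pi ^ DIM('a))" .
qed auto

section \<open>Linear change of variables\<close>

lemma matrix_inv_inverse:
  assumes "invertible A"
  shows "A ** matrix_inv A = mat 1" "matrix_inv A ** A = mat 1"
  using someI_ex[OF assms[unfolded invertible_def]] by (simp_all add: matrix_inv_def)

text \<open>Lebesgue measure is determined by its values on boxes. The preimage of a box under A is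
  its image under the inverse, whose volume is divided by the absolute determinant of A; the density
  restores it.\<close>

lemma lborel_eq_density_distr_linear:
  fixes A :: "real^'n::{finite,wellorder}^'n::_"
  assumes "invertible A"
  shows "lborel = density (distr lborel borel ((*v) A)) (\<lambda>_. ennreal \<bar>det A\<bar>)"
proof (rule lborel_eqI)
  have [measurable]: "(*v) A \<in> borel \<rightarrow>\<^sub>M borel"
    by (intro borel_measurable_continuous_onI continuous_intros)
  fix l u :: "real^'n::_"
  assume le: "\<And>b. b \<in> Basis \<Longrightarrow> l \<bullet> b \<le> u \<bullet> b"
  let ?B = "matrix_inv A"
  have inv: "A ** ?B = mat 1" "?B ** A = mat 1"
    using matrix_inv_inverse[OF assms] .
  have vim: "(*v) A -` box l u = (*v) ?B ` box l u"
  proof safe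
    fix x assume "A *v x \<in> box l u"
    then show "x \<in> (*v) ?B ` box l u"
      by (intro image_eqI[of _ _ "A *v x"]) (simp_all add: matrix_vector_mul_assoc inv)
  qed (simp add: matrix_vector_mul_assoc inv)
  have meas: "(*v) ?B ` box l u \<in> lmeasurable"
    by (rule measurable_linear_image) auto
  have "emeasure lborel ((*v) A -` box l u) = emeasure lebesgue ((*v) A -` box l u)"
  proof -
    have "(*v) A -` box l u \<in> sets lborel"
      using measurable_sets[of "(*v) A" borel borel "box l u"] by simp
    then show ?thesis by simp
  qed
  also have "\<dots> = ennreal (\<bar>det ?B\<bar> * measure lebesgue (box l u))"
    unfolding vim using meas
    by (simp add: emeasure_eq_measure2 measure_linear_image)
  finally have em: "emeasure lborel ((*v) A -` box l u) = ennreal (\<bar>det ?B\<bar> * measure lebesgue (box l u))" .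
  have "emeasure (density (distr lborel borel ((*v) A)) (\<lambda>_. ennreal \<bar>det A\<bar>)) (box l u)
      = ennreal \<bar>det A\<bar> * emeasure lborel ((*v) A -` box l u)"
    by (simp add: emeasure_density nn_integral_cmult_indicator emeasure_distr)
  also have "\<dots> = ennreal (\<bar>det A * det ?B\<bar> * measure lebesgue (box l u))"
    by (simp add: em ennreal_mult'[symmetric] abs_mult mult.assoc)
  also have "det A * det ?B = 1"
    by (metis det_I det_mul inv(1))
  also have "ennreal (\<bar>1\<bar> * measure lebesgue (box l u)) = emeasure lborel (box l u)"
    using emeasure_lborel_box_finite[of l u] by (simp add: emeasure_eq_ennreal_measure less_top)
  finally show "emeasure (density (distr lborel borel ((*v) A)) (\<lambda>_. ennreal \<bar>det A\<bar>)) (box l u)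
      = (\<Prod>b\<in>Basis. (u - l) \<bullet> b)"
    using le by (simp add: emeasure_lborel_box)
qed simp

lemma has_bochner_integral_linear_substitution:
  fixes A :: "real^'n::{finite,wellorder}^'n::_" and f :: "real^'n::_ \<Rightarrow> real"
  assumes "invertible A" and f: "has_bochner_integral lborel f I"
  shows "has_bochner_integral lborel (\<lambda>x. f (A *v x)) (I / \<bar>det A\<bar>)"
proof -
  have det: "det A \<noteq> 0" using assms(1) by (simp add: invertible_det_nz)
  have [measurable]: "(*v) A \<in> borel \<rightarrow>\<^sub>M borel"
    by (intro borel_measurable_continuous_onI continuous_intros)
  have [measurable]: "f \<in> borel_measurable borel"
    using borel_measurable_has_bochner_integral[OF f] by simp
  have "has_bochner_integral (density (distr lborel borel ((*v) A)) (\<lambda>_. ennreal \<bar>det A\<bar>)) f I"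
    using f lborel_eq_density_distr_linear[OF assms(1)] by simp
  then have "has_bochner_integral lborel (\<lambda>x. \<bar>det A\<bar> * f (A *v x)) I"
    by (simp add: has_bochner_integral_iff integrable_density integral_density integrable_distr_eq integral_distr)
  then show ?thesis
    using has_bochner_integral_mult_right[of "1 / \<bar>det A\<bar>" lborel "\<lambda>x. \<bar>det A\<bar> * f (A *v x)" I] det
    by simp
qed

section \<open>Lattice sums as integrals of step functions\<close>

definition floor_vec :: "real^'n \<Rightarrow> int^'n" where
  "floor_vec s = (\<chi> h. \<lfloor>s$h\<rfloor>)"

text \<open>Rounding down after scaling by R cuts space into half-open cubes of side 1/R, one for
  each integer vector, so the pushforward weights all integer vectors equally.\<close>

lemma distr_lborel_floor_vec:
  fixes R :: real
  assumes "R > 0"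
  shows "(\<lambda>s :: real^'n. floor_vec (R *\<^sub>R s)) \<in> lborel \<rightarrow>\<^sub>M count_space UNIV"
    and "distr lborel (count_space UNIV) (\<lambda>s :: real^'n. floor_vec (R *\<^sub>R s))
        = density (count_space UNIV) (\<lambda>_. ennreal (1 / R ^ CARD('n)))"
proof -
  define f where "f = (\<lambda>s :: real^'n. floor_vec (R *\<^sub>R s))"
  have vim: "f -` {n} = {s. \<forall>h. of_int (n$h) / R \<le> s$h \<and> s$h < (of_int (n$h) + 1) / R}" for n
  proof -
    have "f s = n \<longleftrightarrow> (\<forall>h. of_int (n$h) \<le> R * s$h \<and> R * s$h < of_int (n$h) + 1)" for s
      by (simp add: f_def floor_vec_def vec_eq_iff floor_eq_iff)
    then show ?thesis using assms by (auto simp: field_simps)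
  qed
  have sets: "f -` {n} \<in> sets borel" for n
    unfolding vim by measurable
  then show meas: "f \<in> lborel \<rightarrow>\<^sub>M count_space UNIV"
    by (simp add: measurable_count_space_eq2_countable)
  have em: "emeasure lborel (f -` {n}) = ennreal (1 / R ^ CARD('n))" for n
  proof -
    define l u :: "real^'n" where "l = (\<chi> h. of_int (n$h) / R)" and "u = (\<chi> h. (of_int (n$h) + 1) / R)"
    have le: "l \<bullet> b \<le> u \<bullet> b" if "b \<in> Basis" for b
      using that assms by (auto simp: Basis_vec_def inner_axis l_def u_def divide_right_mono)
    have "(\<Prod>b\<in>(Basis :: (real^'n) set). (u - l) \<bullet> b) = (\<Prod>b\<in>(Basis :: (real^'n) set). 1 / R)"
      by (rule prod.cong) (auto simp: Basis_vec_def inner_axis l_def u_def add_divide_distrib)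
    then have vol: "(\<Prod>b\<in>(Basis :: (real^'n) set). (u - l) \<bullet> b) = 1 / R ^ CARD('n)"
      by (simp add: power_one_over)
    \<comment> \<open>The half-open cube is squeezed between an open and a closed box of equal
      volume.\<close>
    have "box l u \<subseteq> f -` {n}" "f -` {n} \<subseteq> cbox l u"
      unfolding vim by (auto simp: mem_box_cart l_def u_def less_imp_le)
    then have "emeasure lborel (box l u) \<le> emeasure lborel (f -` {n})"
      "emeasure lborel (f -` {n}) \<le> emeasure lborel (cbox l u)"
      using sets by (auto intro!: emeasure_mono)
    then show ?thesis
      using emeasure_lborel_box[OF le] emeasure_lborel_cbox[OF le] vol by simp
  qed
  show "distr lborel (count_space UNIV) f = density (count_space UNIV) (\<lambda>_. ennreal (1 / R ^ CARD('n)))"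
  proof (rule measure_eqI_countable)
    show "countable (UNIV :: (int^'n) set)" by simp
    fix n :: "int^'n"
    show "emeasure (distr lborel (count_space UNIV) f) {n}
        = emeasure (density (count_space UNIV) (\<lambda>_. ennreal (1 / R ^ CARD('n)))) {n}"
      using meas em by (simp add: emeasure_distr emeasure_density nn_integral_cmult_indicator)
  qed auto
qed

text \<open>Turns Riemann sums of varying mesh into integrals over one fixed space, where dominated
  convergence applies.\<close>

lemma infsum_eq_lborel_integral:
  fixes F :: "int^'n \<Rightarrow> real"
  assumes R: "R > 0" and int: "integrable lborel (\<lambda>s :: real^'n. F (floor_vec (R *\<^sub>R s)))"
  shows "(\<Sum>\<^sub>\<infinity>n. F n) / R ^ CARD('n) = (\<integral>s. F (floor_vec (R *\<^sub>R s)) \<partial>lborel)"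
proof -
  note m = distr_lborel_floor_vec[OF R, where 'n='n]
  have eq: "(\<integral>s. F (floor_vec (R *\<^sub>R s)) \<partial>lborel) = (\<integral>n. F n \<partial>count_space UNIV) / R ^ CARD('n)"
    using integral_distr[OF m(1), of F] R unfolding m(2)
    by (simp add: integral_density)
  have "integrable (count_space UNIV) (\<lambda>n. (1 / R ^ CARD('n)) *\<^sub>R F n)"
    using int integrable_distr_eq[OF m(1), of F] R unfolding m(2)
    by (simp add: integrable_density)
  then have "integrable (count_space UNIV) (\<lambda>n. R ^ CARD('n) *\<^sub>R ((1 / R ^ CARD('n)) *\<^sub>R F n))"
    by (rule integrable_scaleR_right)
  then have "integrable (count_space UNIV) F"
    using R by simp
  then have "(\<integral>n. F n \<partial>count_space UNIV) = (\<Sum>\<^sub>\<infinity>n. F n)"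
    using infsetsum_infsum[of F UNIV] by (simp add: infsetsum_def abs_summable_on_def)
  then show ?thesis using eq by simp
qed

lemma norm_floor_vec_diff_le:
  fixes s :: "real^'n"
  assumes "R > 0"
  shows "norm ((1 / R) *\<^sub>R ivec (floor_vec (R *\<^sub>R s)) - s) \<le> real CARD('n) / R"
proof -
  have "\<bar>((1 / R) *\<^sub>R ivec (floor_vec (R *\<^sub>R s)) - s) $ h\<bar> \<le> 1 / R" for h
  proof -
    have "\<bar>of_int \<lfloor>R * s$h\<rfloor> / R - s$h\<bar> = \<bar>(of_int \<lfloor>R * s$h\<rfloor> - R * s$h) / R\<bar>"
      using assms by (simp add: diff_divide_distrib)
    also have "\<dots> = \<bar>of_int \<lfloor>R * s$h\<rfloor> - R * s$h\<bar> / R"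
      using assms by (simp only: abs_divide abs_of_pos)
    also have "\<dots> \<le> 1 / R"
      using assms by (intro divide_right_mono) linarith+
    finally show ?thesis by (simp add: floor_vec_def)
  qed
  then have "(\<Sum>h\<in>UNIV. \<bar>((1 / R) *\<^sub>R ivec (floor_vec (R *\<^sub>R s)) - s) $ h\<bar>) \<le> (\<Sum>h\<in>(UNIV::'n set). 1 / R)"
    by (rule sum_mono)
  then show ?thesis
    using norm_le_l1_cart[of "(1 / R) *\<^sub>R ivec (floor_vec (R *\<^sub>R s)) - s"] by simp
qed

text \<open>The rescaled sum is the integral of a step function of mesh 1/R that converges pointwise
  to the Gaussian composed with b; the determinant comes from the substitution. The shift q is lost
  in the limit since q/R tends to 0.\<close>

lemma gaussian_lattice_sum_tendsto:
  assumes det: "det b \<noteq> 0"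
  shows "(\<lambda>k. (\<Sum>\<^sub>\<infinity>l\<in>zspan b. exp (- (norm (q + l) / real (Suc k))\<^sup>2)) / real (Suc k) ^ 4)
      \<longlonglongrightarrow> pi\<^sup>2 / \<bar>det b\<bar>"
proof -
  define R where "R k = real (Suc k)" for k
  have R: "R k > 0" "R k \<ge> 1" for k by (simp_all add: R_def)
  have inv: "invertible (transpose b)" using det by (simp add: invertible_det_nz)
  obtain B where B: "B > 0" "\<And>v. norm (v v* b) \<le> B * norm v"
    using linear_bounded_pos[OF linear_vector_matrix_mult[of b]] by (metis mult.commute)
  \<comment> \<open>C collects the shift q and the rounding error; 4 is the dimension in
    \<open>norm_floor_vec_diff_le\<close>.\<close>
  define C where "C = norm q + B * 4"
  have C: "C \<ge> 0" using B(1) by (simp add: C_def)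
  define y where "y k s = (1 / R k) *\<^sub>R (q + ivec (floor_vec (R k *\<^sub>R s)) v* b)" for k s
  have close: "norm (y k s - s v* b) \<le> C / R k" for k s
  proof -
    let ?d = "(1 / R k) *\<^sub>R ivec (floor_vec (R k *\<^sub>R s)) - s"
    have "y k s - s v* b = (1 / R k) *\<^sub>R q + ?d v* b"
      unfolding y_def linear_diff[OF linear_vector_matrix_mult] linear_scale[OF linear_vector_matrix_mult]
      by (simp add: algebra_simps)
    also have "norm \<dots> \<le> norm ((1 / R k) *\<^sub>R q) + norm (?d v* b)"
      by (rule norm_triangle_ineq)
    also have "norm (?d v* b) \<le> B * (4 / R k)"
      using order_trans[OF B(2)[of ?d] mult_left_mono[OF norm_floor_vec_diff_le[OF R(1), of k s]]] B(1)
      by simp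
    finally show ?thesis
      using R(1)[of k] by (simp add: C_def add_divide_distrib)
  qed
  have lim: "(\<lambda>k. y k s) \<longlonglongrightarrow> s v* b" for s
  proof -
    have "(\<lambda>k. C / R k) \<longlonglongrightarrow> 0"
      unfolding R_def by (rule LIMSEQ_Suc[OF lim_const_over_n])
    moreover have "\<forall>\<^sub>F k in sequentially. norm (y k s - s v* b) \<le> C / R k"
      using close by (intro always_eventually) auto
    ultimately have "(\<lambda>k. y k s - s v* b) \<longlonglongrightarrow> 0"
      by (rule Lim_null_comparison[rotated])
    then show ?thesis by (simp add: LIM_zero_iff)
  qed
  \<comment> \<open>A majorant independent of k. Squaring the triangle inequality loses a factor 2
    in the exponent, which is put into the matrix as 1 / sqrt 2, so that integrability follows from
    the same linear substitution.\<close>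
  define G where "G s = exp (C\<^sup>2) * exp (- (norm (((1 / sqrt 2) *\<^sub>R transpose b) *v s))\<^sup>2)" for s
  have G: "integrable lborel G"
    unfolding G_def
    using has_bochner_integral_linear_substitution[OF scalar_invertible[OF _ inv] has_bochner_integral_gaussian, of "1 / sqrt 2"]
    by (intro integrable_mult_right) (simp add: has_bochner_integral_iff)
  have dom: "exp (- (norm (y k s))\<^sup>2) \<le> G s" for k s
  proof -
    have "C / R k \<le> C"
      using R(2)[of k] C by (simp add: divide_le_eq mult_le_cancel_left1)
    then have "norm (s v* b) \<le> norm (y k s) + C"
      using close[of k s] norm_triangle_ineq4[of "y k s" "y k s - s v* b"] by simp
    then have "(norm (s v* b))\<^sup>2 \<le> (norm (y k s) + C)\<^sup>2"
      by (intro power_mono) auto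
    also have "\<dots> \<le> 2 * (norm (y k s))\<^sup>2 + 2 * C\<^sup>2"
      using sum_squares_bound[of "norm (y k s)" C] by (simp add: power2_sum)
    finally have "- (norm (y k s))\<^sup>2 \<le> C\<^sup>2 - (norm (s v* b))\<^sup>2 / 2"
      by simp
    moreover have "(norm (((1 / sqrt 2) *\<^sub>R transpose b) *v s))\<^sup>2 = (norm (s v* b))\<^sup>2 / 2"
    proof -
      have "((1 / sqrt 2) *\<^sub>R transpose b) *v s = (1 / sqrt 2) *\<^sub>R (s v* b)"
        by (simp add: scaleR_matrix_vector_assoc[symmetric])
      then show ?thesis by (simp add: power_divide)
    qed
    ultimately show ?thesis
      by (simp add: G_def exp_add[symmetric])
  qed
  have meas: "(\<lambda>s. exp (- (norm (y k s))\<^sup>2)) \<in> borel_measurable lborel" for k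
    unfolding y_def
    by (rule measurable_compose[OF distr_lborel_floor_vec(1)[OF R(1)]]) auto
  have meas': "(\<lambda>s. exp (- (norm (s v* b))\<^sup>2)) \<in> borel_measurable lborel"
    using linear_continuous_on[OF linear_vector_matrix_mult[of b, unfolded linear_conv_bounded_linear], of UNIV]
    by (simp, intro borel_measurable_continuous_onI continuous_intros)
  have ae: "AE s in lborel. (\<lambda>k. exp (- (norm (y k s))\<^sup>2)) \<longlonglongrightarrow> exp (- (norm (s v* b))\<^sup>2)"
    "\<And>k. AE s in lborel. norm (exp (- (norm (y k s))\<^sup>2)) \<le> G s"
    using tendsto_exp[OF tendsto_minus[OF tendsto_power[OF tendsto_norm[OF lim]]]] dom by (intro AE_I2; simp)+
  have "(\<lambda>k. \<integral>s. exp (- (norm (y k s))\<^sup>2) \<partial>lborel) \<longlonglongrightarrow> (\<integral>s. exp (- (norm (s v* b))\<^sup>2) \<partial>lborel)"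
    by (rule integral_dominated_convergence[OF meas' meas G ae])
  moreover have "(\<integral>s. exp (- (norm (s v* b))\<^sup>2) \<partial>lborel) = pi\<^sup>2 / \<bar>det b\<bar>"
  proof -
    have "sqrt pi ^ 4 = pi\<^sup>2"
      by (simp add: power4_eq_xxxx power2_eq_square)
    then show ?thesis
      using has_bochner_integral_linear_substitution[OF inv has_bochner_integral_gaussian]
      by (simp add: has_bochner_integral_iff)
  qed
  moreover have "(\<integral>s. exp (- (norm (y k s))\<^sup>2) \<partial>lborel)
      = (\<Sum>\<^sub>\<infinity>l\<in>zspan b. exp (- (norm (q + l) / R k)\<^sup>2)) / R k ^ 4" for k
  proof -
    have "integrable lborel (\<lambda>s. exp (- (norm (y k s))\<^sup>2))"
      by (rule integrable_dominated_convergence2[OF meas' meas G ae])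
    then have "(\<integral>s. exp (- (norm (y k s))\<^sup>2) \<partial>lborel)
        = (\<Sum>\<^sub>\<infinity>n. exp (- (norm ((1 / R k) *\<^sub>R (q + ivec n v* b)))\<^sup>2)) / R k ^ 4"
      unfolding y_def
      using infsum_eq_lborel_integral[OF R(1), of "\<lambda>n. exp (- (norm ((1 / R k) *\<^sub>R (q + ivec n v* b)))\<^sup>2)" k]
      by simp
    also have "(\<Sum>\<^sub>\<infinity>n. exp (- (norm ((1 / R k) *\<^sub>R (q + ivec n v* b)))\<^sup>2))
        = (\<Sum>\<^sub>\<infinity>l\<in>zspan b. exp (- (norm (q + l) / R k)\<^sup>2))"
    proof -
      have "inj (\<lambda>n. ivec n v* b)"
        using inj_compose[OF inj_vector_matrix_mult[OF det] inj_ivec] by (simp add: o_def)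
      then show ?thesis
        unfolding zspan_eq using R(1)[of k] by (subst infsum_reindex) (simp_all add: o_def)
    qed
    finally show ?thesis .
  qed
  ultimately show ?thesis by (simp add: R_def)
qed

section \<open>Finite combinations of convergent series\<close>

lemma has_sum_sum:
  fixes f :: "'i \<Rightarrow> 'a \<Rightarrow> 'b::topological_comm_monoid_add"
  assumes "finite I" "\<And>i. i \<in> I \<Longrightarrow> (f i has_sum S i) A"
  shows "((\<lambda>x. \<Sum>i\<in>I. f i x) has_sum (\<Sum>i\<in>I. S i)) A"
  using assms by (induction I rule: finite_induct) (auto intro: has_sum_add has_sum_0)

lemma has_sum_diff:
  fixes f g :: "'a \<Rightarrow> 'b::real_normed_vector"
  assumes "(f has_sum S) A" "(g has_sum T) A"
  shows "((\<lambda>x. f x - g x) has_sum (S - T)) A"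
  using has_sum_add[OF assms(1) has_sum_bounded_linear[OF bounded_linear_minus[OF bounded_linear_ident] assms(2)]]
  by simp

subsection \<open>A radial cutoff\<close>

text \<open>For \<open>\<phi> x = cutoff (norm x ^ 2)\<close> the first-order operator that annihilates \<open>Gfun\<close> gives
  \<open>-(\<Sum>\<alpha>. e_\<alpha> \<partial>_\<alpha> \<phi>) Gfun x = 2 exp (-(norm x)^2)\<close>: since the derivative of \<open>cutoff\<close> vanishes at 0,
  the singularity of \<open>Gfun\<close> cancels and a Gaussian remains.\<close>

definition cutoff :: "real \<Rightarrow> real" where
  "cutoff r = (1 + r) * exp (- r)"

text \<open>The first two bounds dominate the cutoff series, the third gives the decay that makes
  its separate pieces summable, and the fourth controls the expansion error.\<close>

lemma cutoff_bounds:
  assumes "r \<ge> 0"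
  shows "0 \<le> cutoff r" "cutoff r \<le> 1" "cutoff r * r \<le> 3" "r * (r * exp (- r)) \<le> 2"
proof -
  have e: "1 + r + r\<^sup>2 / 2 \<le> exp r"
    using exp_lower_Taylor_quadratic[OF assms] .
  show "0 \<le> cutoff r" using assms by (simp add: cutoff_def)
  have "1 + r \<le> exp r" by simp
  then show "cutoff r \<le> 1" by (simp add: cutoff_def exp_minus field_simps)
  have "r + r\<^sup>2 \<le> 3 * exp r" "r\<^sup>2 \<le> 2 * exp r"
    using e assms zero_le_power2[of r] by linarith+
  then show "cutoff r * r \<le> 3" "r * (r * exp (- r)) \<le> 2"
    by (auto simp: cutoff_def exp_minus field_simps power2_eq_square)
qed

text \<open>The first derivative of \<open>cutoff\<close> at r is - r exp (- r); the second, (r - 1)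
  exp (- r), is of order -2 in m beyond m.\<close>

lemma cutoff_taylor:
  assumes m: "m > 0" "m \<le> r" "m \<le> s"
  shows "\<bar>cutoff s - cutoff r + r * exp (- r) * (s - r)\<bar> \<le> 15 * (s - r)\<^sup>2 / m\<^sup>2"
proof (cases "s = r")
  case False
  define diff where "diff = (\<lambda>n::nat. \<lambda>r::real.
    if n = 0 then cutoff r else if n = 1 then - r * exp (- r) else (r - 1) * exp (- r))"
  have "\<exists>t. (if s < r then s < t \<and> t < r else r < t \<and> t < s) \<and>
      cutoff s = (\<Sum>k<2. (diff k r / fact k) * (s - r) ^ k) + (diff 2 t / fact 2) * (s - r)\<^sup>2"
  proof (rule Taylor[where a = "min r s" and b = "max r s"])
    show "\<forall>k t. k < 2 \<and> min r s \<le> t \<and> t \<le> max r s \<longrightarrow> DERIV (diff k) t :> diff (Suc k) t"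
    proof (intro allI impI)
      fix k :: nat and t :: real assume "k < 2 \<and> min r s \<le> t \<and> t \<le> max r s"
      then consider "k = 0" | "k = 1" by linarith
      then show "DERIV (diff k) t :> diff (Suc k) t"
        by cases (auto simp: diff_def cutoff_def algebra_simps intro!: derivative_eq_intros)
    qed
  qed (use False in \<open>auto simp: diff_def\<close>)
  then obtain t where t': "if s < r then s < t \<and> t < r else r < t \<and> t < s"
    and t: "cutoff s = (\<Sum>k<2. (diff k r / fact k) * (s - r) ^ k) + (diff 2 t / fact 2) * (s - r)\<^sup>2"
    by blast
  have mt: "m \<le> t"
    using t' m by (simp split: if_splits)
  have "cutoff s - cutoff r + r * exp (- r) * (s - r) = (t - 1) * exp (- t) / 2 * (s - r)\<^sup>2"
    unfolding t by (simp add: diff_def numeral_2_eq_2)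
  moreover have "\<bar>(t - 1) * exp (- t) / 2\<bar> \<le> 15 / m\<^sup>2"
  proof -
    have t0: "t > 0" using mt m by simp
    \<comment> \<open>Cubing t/3 <= exp (t/3) bounds the cube of t by 27 exp t, and the square of t
      is at most 2 exp t. The total 29 is rounded up to 30, whose half is 15.\<close>
    have "(t / 3) ^ 3 \<le> exp (t / 3) ^ 3"
      using t0 exp_ge_add_one_self[of "t / 3"] by (intro power_mono) linarith+
    then have "t ^ 3 / 27 \<le> exp t"
      using exp_divide_power_eq[of 3 t] by (simp add: power_divide)
    moreover have "t\<^sup>2 / 2 \<le> exp t"
      using exp_lower_Taylor_quadratic[of t] t0 by linarith
    moreover have "\<bar>t - 1\<bar> * t\<^sup>2 \<le> t ^ 3 + t\<^sup>2"
    proof -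
      have "\<bar>t - 1\<bar> * t\<^sup>2 \<le> (t + 1) * t\<^sup>2" using t0 by (intro mult_right_mono) auto
      then show ?thesis by (simp add: algebra_simps eval_nat_numeral)
    qed
    ultimately have "\<bar>t - 1\<bar> * t\<^sup>2 \<le> 30 * exp t"
      using exp_gt_zero[of t] by linarith
    then have "\<bar>(t - 1) * exp (- t) / 2\<bar> \<le> 15 / t\<^sup>2"
      using t0 by (simp add: abs_mult exp_minus field_simps)
    also have "\<dots> \<le> 15 / m\<^sup>2"
      using mt m by (intro divide_left_mono power_mono) auto
    finally show ?thesis .
  qed
  ultimately have "\<bar>cutoff s - cutoff r + r * exp (- r) * (s - r)\<bar> \<le> 15 / m\<^sup>2 * (s - r)\<^sup>2"
    by (simp only: abs_mult abs_power2) (rule mult_right_mono, simp_all)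
  then show ?thesis by simp
qed simp

text \<open>Error of the first-order expansion of the dilated cutoff at x under the displacement v:
  the last summand is minus the directional derivative.\<close>

definition cutoff_error :: "real \<Rightarrow> real^4 \<Rightarrow> real^4 \<Rightarrow> real" where
  "cutoff_error R x v = cutoff ((norm (x + v) / R)\<^sup>2) - cutoff ((norm x / R)\<^sup>2)
     + 2 / R\<^sup>2 * ((norm x / R)\<^sup>2 * exp (- (norm x / R)\<^sup>2)) * (x \<bullet> v)"

text \<open>The constant does not depend on R, because the Taylor bound involves only the
  scale-invariant ratio of s - r to r. Multiplied by \<open>Gfun\<close>, of degree -3, the error
  has a summable majorant of degree -5 common to all R.\<close>

lemma cutoff_error_bound:
  fixes v :: "real^4"
  assumes "\<delta> > 0"
  shows "\<exists>C. \<forall>R x. 0 < R \<longrightarrow> \<delta> \<le> norm x \<longrightarrow> \<delta> \<le> norm (x + v) \<longrightarrow>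
    \<bar>cutoff_error R x v\<bar> \<le> C / (norm x)\<^sup>2"
proof -
  define M where "M = norm v / \<delta>"
  define c where "c = 1 / (1 + M)"
  have M: "M \<ge> 0" using assms by (simp add: M_def)
  then have c: "c > 0" "c \<le> 1" by (simp_all add: c_def)
  define K where "K = (2 + M)\<^sup>2 * (norm v)\<^sup>2"
  define C where "C = 15 * K / c ^ 4 + 2 * (norm v)\<^sup>2"
  have "\<bar>cutoff_error R x v\<bar> \<le> C / (norm x)\<^sup>2"
    if R: "0 < R" and x: "\<delta> \<le> norm x" and xv: "\<delta> \<le> norm (x + v)" for R x
  proof -
    define a where "a = norm x"
    define r where "r = (a / R)\<^sup>2"
    define s where "s = (norm (x + v) / R)\<^sup>2"
    have a: "a > 0" unfolding a_def using x assms by linarith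
    have r: "r > 0" using a R by (simp add: r_def)
    have "a \<le> (1 + M) * norm (x + v)"
      unfolding a_def M_def by (rule norm_comparable_translate[OF assms xv])
    then have "c * a \<le> norm (x + v)"
      using M by (simp add: c_def field_simps)
    then have "(c * a / R)\<^sup>2 \<le> s"
      unfolding s_def using c a R by (intro power_mono divide_right_mono) auto
    then have cs: "c\<^sup>2 * r \<le> s"
      by (simp add: r_def power_mult_distrib power_divide)
    have "c\<^sup>2 \<le> 1" using c by (simp add: power_le_one)
    then have cr: "c\<^sup>2 * r \<le> r"
      using r by (simp add: mult_le_cancel_right1)
    have d: "s - r = (2 * (x \<bullet> v) + (norm v)\<^sup>2) / R\<^sup>2"
      by (simp add: s_def r_def a_def power_divide diff_divide_distrib[symmetric] power2_norm_eq_inner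
          inner_add_left inner_add_right inner_commute)
    have "norm v \<le> M * a"
      using mult_right_mono[OF x, of "norm v"] assms by (simp add: M_def a_def field_simps)
    then have "(norm v)\<^sup>2 \<le> M * a * norm v"
      unfolding power2_eq_square by (intro mult_right_mono) auto
    moreover have "\<bar>x \<bullet> v\<bar> \<le> a * norm v"
      unfolding a_def by (rule Cauchy_Schwarz_ineq2)
    moreover have "0 \<le> (norm v)\<^sup>2"
      by simp
    ultimately have "\<bar>2 * (x \<bullet> v) + (norm v)\<^sup>2\<bar> \<le> 2 * (a * norm v) + M * a * norm v"
      by linarith
    then have "\<bar>2 * (x \<bullet> v) + (norm v)\<^sup>2\<bar> \<le> (2 + M) * norm v * a"
      by (simp add: algebra_simps)
    then have "(2 * (x \<bullet> v) + (norm v)\<^sup>2)\<^sup>2 \<le> ((2 + M) * norm v * a)\<^sup>2"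
      by (metis abs_ge_zero power2_abs power_mono)
    then have "(2 * (x \<bullet> v) + (norm v)\<^sup>2)\<^sup>2 / (R\<^sup>2)\<^sup>2 \<le> K * a\<^sup>2 / (R\<^sup>2)\<^sup>2"
      using R by (intro divide_right_mono) (auto simp: K_def power_mult_distrib)
    then have d2: "(s - r)\<^sup>2 \<le> K * a\<^sup>2 / (R\<^sup>2)\<^sup>2"
      unfolding d by (simp add: power_divide)
    \<comment> \<open>\<open>c\<^sup>2 * r\<close> lies below both r and s and plays the role of m
      in \<open>cutoff_taylor\<close>.\<close>
    have "\<bar>cutoff s - cutoff r + r * exp (- r) * (s - r)\<bar> \<le> 15 * (s - r)\<^sup>2 / (c\<^sup>2 * r)\<^sup>2"
      using c r cs cr by (intro cutoff_taylor) auto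
    also have "\<dots> \<le> 15 * (K * a\<^sup>2 / (R\<^sup>2)\<^sup>2) / (c\<^sup>2 * r)\<^sup>2"
      using d2 by (intro divide_right_mono mult_left_mono) auto
    also have "\<dots> = 15 * K / c ^ 4 / a\<^sup>2"
      using a R c by (simp add: r_def field_simps eval_nat_numeral)
    finally have 1: "\<bar>cutoff s - cutoff r + r * exp (- r) * (s - r)\<bar> \<le> 15 * K / c ^ 4 / a\<^sup>2" .
    \<comment> \<open>\<open>cutoff_error\<close> is linear in v in its last summand, whereas s - r
      also contains the squared norm of v over that of R. This surplus is bounded here.\<close>
    have "r * exp (- r) * (norm v)\<^sup>2 / R\<^sup>2 = r * (r * exp (- r)) * ((norm v)\<^sup>2 / a\<^sup>2)"
      using a R by (simp add: r_def field_simps)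
    also have "\<dots> \<le> 2 * ((norm v)\<^sup>2 / a\<^sup>2)"
      using cutoff_bounds(4)[of r] r by (intro mult_right_mono) auto
    finally have 2: "r * exp (- r) * (norm v)\<^sup>2 / R\<^sup>2 \<le> 2 * (norm v)\<^sup>2 / a\<^sup>2" by simp
    have 3: "0 \<le> r * exp (- r) * (norm v)\<^sup>2 / R\<^sup>2" using r by simp
    have "cutoff_error R x v
        = (cutoff s - cutoff r + r * exp (- r) * (s - r)) - r * exp (- r) * (norm v)\<^sup>2 / R\<^sup>2"
      unfolding cutoff_error_def d a_def[symmetric] r_def[symmetric] s_def[symmetric]
      by (simp add: add_divide_distrib distrib_left)
    then have "\<bar>cutoff_error R x v\<bar> \<le> 15 * K / c ^ 4 / a\<^sup>2 + 2 * (norm v)\<^sup>2 / a\<^sup>2"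
      using 1 2 3 by linarith
    then show ?thesis by (simp add: C_def a_def add_divide_distrib)
  qed
  then show ?thesis by blast
qed

lemma tendsto_cutoff_dilate:
  "(\<lambda>k. cutoff ((a / real (Suc k))\<^sup>2)) \<longlonglongrightarrow> 1"
proof -
  have "(\<lambda>k. (a / real (Suc k))\<^sup>2) \<longlonglongrightarrow> 0\<^sup>2"
    by (intro tendsto_power LIMSEQ_Suc[OF lim_const_over_n])
  then have "(\<lambda>k. cutoff ((a / real (Suc k))\<^sup>2)) \<longlonglongrightarrow> (1 + 0\<^sup>2) * exp (- 0\<^sup>2)"
    unfolding cutoff_def by (intro tendsto_mult tendsto_add tendsto_exp tendsto_minus tendsto_const)
  then show ?thesis by simp
qed

lemma tendsto_cutoff_error:
  "(\<lambda>k. cutoff_error (real (Suc k)) x v) \<longlonglongrightarrow> 0"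
proof -
  have 0: "(\<lambda>k. a / real (Suc k)) \<longlonglongrightarrow> 0" for a
    by (rule LIMSEQ_Suc[OF lim_const_over_n])
  have "(\<lambda>k. 2 * (1 / real (Suc k))\<^sup>2 * ((norm x / real (Suc k))\<^sup>2 * exp (- (norm x / real (Suc k))\<^sup>2)) * (x \<bullet> v))
      \<longlonglongrightarrow> 2 * 0\<^sup>2 * (0\<^sup>2 * exp (- 0\<^sup>2)) * (x \<bullet> v)"
    by (intro tendsto_mult tendsto_power tendsto_exp tendsto_minus tendsto_const 0)
  then have "(\<lambda>k. cutoff_error (real (Suc k)) x v) \<longlonglongrightarrow> 1 - 1 + 2 * 0\<^sup>2 * (0\<^sup>2 * exp (- 0\<^sup>2)) * (x \<bullet> v)"
    unfolding cutoff_error_def by (intro tendsto_add tendsto_diff tendsto_cutoff_dilate) (simp add: power_divide)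
  then show ?thesis by simp
qed

subsection \<open>The zeta function and its periods\<close>

text \<open>With l as base point and q as increment, every term with nonzero l is a remainder from
  \<open>Gfun_taylor\<close>. The single term at l = 0 is added afterwards.\<close>

lemma zeta_term_summable:
  assumes det: "det b \<noteq> 0" and q: "q \<notin> zspan b"
  shows "(\<lambda>l. Gfun (q + l) - Gfun l - dG l q) summable_on zspan b"
proof -
  let ?L = "zspan b"
  have nz: "q + l \<noteq> 0" if "l \<in> ?L" for l
    using zspan_uminus[OF that] q by (metis add_eq_0_iff2)
  obtain c where c: "c > 0" "\<And>l. l \<in> ?L \<Longrightarrow> 0 + l \<noteq> 0 \<Longrightarrow> c \<le> norm (0 + l)"
    using lattice_separated[OF det] by blast
  obtain d where d: "d > 0" "\<And>l. l \<in> ?L \<Longrightarrow> q + l \<noteq> 0 \<Longrightarrow> d \<le> norm (q + l)"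
    using lattice_separated[OF det] by blast
  define \<delta> where "\<delta> = min c d"
  have \<delta>: "\<delta> > 0" using c(1) d(1) by (simp add: \<delta>_def)
  obtain C where C: "\<And>x. \<delta> \<le> norm x \<Longrightarrow> \<delta> \<le> norm (x + q) \<Longrightarrow>
      norm (Gfun (x + q) - Gfun x - dG x q) \<le> C / norm x ^ 5"
    using Gfun_taylor[OF \<delta>] by blast
  have "(\<lambda>l. norm (Gfun (q + l) - Gfun l - dG l q)) summable_on ?L - {0}"
  proof (rule Infinite_Sum.abs_summable_on_comparison_test')
    have "(\<lambda>l. 1 / norm (0 + l) ^ 5) summable_on ?L - {0}"
      by (rule summable_on_subset_banach[OF summable_on_zspan[OF det]]) auto
    then show "(\<lambda>l. C * (1 / norm (0 + l) ^ 5)) summable_on ?L - {0}"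
      by (rule summable_on_cmult_right)
    fix l assume "l \<in> ?L - {0}"
    then show "norm (Gfun (q + l) - Gfun l - dG l q) \<le> C * (1 / norm (0 + l) ^ 5)"
      using C[of l] c(2)[of l] d(2)[of l] nz[of l] by (simp add: \<delta>_def add.commute)
  qed
  then have "(\<lambda>l. Gfun (q + l) - Gfun l - dG l q) summable_on ?L - {0}"
    by (rule abs_summable_summable)
  from has_sum_insert[OF _ has_sum_infsum[OF this], of 0]
  have "(\<lambda>l. Gfun (q + l) - Gfun l - dG l q) summable_on insert 0 (?L - {0})"
    unfolding summable_on_def by blast
  then show ?thesis
    by (simp add: insert_absorb[OF zspan_0])
qed

text \<open>The junk values \<open>Gfun 0 = 0\<close> and \<open>dG 0 q = 0\<close> allow the exceptional term at \<open>l = 0\<close> to be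
  absorbed into the sum.\<close>
lemma wzeta_has_sum:
  assumes det: "det b \<noteq> 0" and q: "q \<notin> zspan b"
  shows "((\<lambda>l. Gfun (q + l) - Gfun l - dG l q) has_sum wzeta (zspan b) q) (zspan b)"
proof -
  let ?L = "zspan b" and ?T = "\<lambda>l. Gfun (q + l) - Gfun l - dG l q"
  have "infsum ?T (?L - {0})
      = (\<Sum>\<^sub>\<infinity>l\<in>?L - {0}. Gfun (q + l) - Gfun l + (\<Sum>j\<in>{1,2,3::4}. qmul (Gpart j l) (zfun j q)))"
  proof (rule infsum_cong)
    fix l assume "l \<in> ?L - {0}"
    then have "l \<noteq> 0" by simp
    then show "?T l = Gfun (q + l) - Gfun l + (\<Sum>j\<in>{1,2,3::4}. qmul (Gpart j l) (zfun j q))"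
      using sum_Gpart_zfun[of l q] by simp
  qed
  moreover have "infsum ?T (insert 0 (?L - {0})) = ?T 0 + infsum ?T (?L - {0})"
    by (rule infsum_insert) (auto intro: summable_on_subset_banach[OF zeta_term_summable[OF assms]])
  ultimately have "infsum ?T ?L = wzeta ?L q"
    by (simp add: insert_absorb[OF zspan_0] wzeta_def)
  then show ?thesis
    using has_sum_infsum[OF zeta_term_summable[OF assms]] by simp
qed

text \<open>When the two zeta series are subtracted, linearity of \<open>dG l\<close> removes q from
  the correction.\<close>

lemma wzeta_period_has_sum:
  assumes det: "det b \<noteq> 0" and q: "q \<notin> zspan b" and \<mu>: "\<mu> \<in> zspan b"
  shows "((\<lambda>l. Gfun (q + l + \<mu>) - Gfun (q + l) - dG l \<mu>) has_sum
    (wzeta (zspan b) (q + \<mu>) - wzeta (zspan b) q)) (zspan b)"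
proof -
  have q\<mu>: "q + \<mu> \<notin> zspan b"
    using zspan_add[OF _ zspan_uminus[OF \<mu>], of "q + \<mu>"] q by auto
  have eq: "Gfun (q + \<mu> + l) - Gfun l - dG l (q + \<mu>) - (Gfun (q + l) - Gfun l - dG l q)
      = Gfun (q + l + \<mu>) - Gfun (q + l) - dG l \<mu>" for l
    by (simp add: linear_add[OF linear_dG] ac_simps)
  show ?thesis
    using has_sum_diff[OF wzeta_has_sum[OF det q\<mu>] wzeta_has_sum[OF det q]] unfolding eq .
qed

subsection \<open>The dual basis\<close>

text \<open>The quaternion written as lambda-hat with index i: the i-th row of cofactors, which is
  \<open>det b\<close> times a dual basis vector.\<close>

definition dual_row :: "real^4^4 \<Rightarrow> 4 \<Rightarrow> real^4" where
  "dual_row b i = (det b *\<^sub>R transpose (matrix_inv b)) $ i"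

lemma dual_row_nth: "dual_row b i $ \<alpha> = det b * matrix_inv b $ \<alpha> $ i"
  by (simp add: dual_row_def transpose_def)

lemma dual_row_inner:
  assumes "det b \<noteq> 0"
  shows "dual_row b j \<bullet> b $ k = (if j = k then det b else 0)"
proof -
  have "dual_row b j \<bullet> b $ k = det b * (b ** matrix_inv b) $ k $ j"
    by (simp add: inner_vec_def dual_row_nth matrix_matrix_mult_def sum_distrib_left mult_ac)
  also have "b ** matrix_inv b = mat 1"
    using assms by (intro matrix_inv_inverse) (simp add: invertible_det_nz)
  finally show ?thesis by (auto simp: mat_def)
qed

text \<open>The sum of tensors of dual rows with basis rows is \<open>det b\<close> times the
  corresponding sum for the standard basis. Hence lattice directions can be exchanged for coordinate
  directions in any linear expression.\<close>

lemma sum_qmul_dual_row: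
  assumes det: "det b \<noteq> 0" and f: "linear f"
  shows "(\<Sum>h\<in>UNIV. qmul (dual_row b h) (f (b$h))) = det b *\<^sub>R (\<Sum>\<alpha>\<in>UNIV. qmul (axis \<alpha> 1) (f (axis \<alpha> 1)))"
proof -
  let ?e = "\<lambda>\<alpha>. axis \<alpha> 1 :: real^4"
  have expand: "x = (\<Sum>\<alpha>\<in>UNIV. x$\<alpha> *\<^sub>R ?e \<alpha>)" for x :: "real^4"
    by (simp add: vec_eq_iff axis_def if_distrib cong: if_cong)
  have f_expand: "f x = (\<Sum>\<beta>\<in>UNIV. x$\<beta> *\<^sub>R f (?e \<beta>))" for x
    by (subst expand) (simp add: linear_sum[OF f] linear_scale[OF f])
  have coeff: "(\<Sum>h\<in>UNIV. dual_row b h $ \<alpha> * b$h$\<beta>) = (if \<alpha> = \<beta> then det b else 0)" for \<alpha> \<beta>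
  proof -
    have "(\<Sum>h\<in>UNIV. dual_row b h $ \<alpha> * b$h$\<beta>) = det b * (matrix_inv b ** b) $ \<alpha> $ \<beta>"
      by (simp add: dual_row_nth matrix_matrix_mult_def sum_distrib_left mult_ac)
    also have "matrix_inv b ** b = mat 1"
      using det by (intro matrix_inv_inverse) (simp add: invertible_det_nz)
    finally show ?thesis by (auto simp: mat_def)
  qed
  have "qmul (dual_row b h) (f (b$h))
      = (\<Sum>\<alpha>\<in>UNIV. \<Sum>\<beta>\<in>UNIV. (dual_row b h $ \<alpha> * b$h$\<beta>) *\<^sub>R qmul (?e \<alpha>) (f (?e \<beta>)))" for h
  proof -
    have "qmul (dual_row b h) (f (b$h))
        = qmul (\<Sum>\<alpha>\<in>UNIV. dual_row b h $ \<alpha> *\<^sub>R ?e \<alpha>) (\<Sum>\<beta>\<in>UNIV. b$h$\<beta> *\<^sub>R f (?e \<beta>))"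
      by (simp only: expand[symmetric] f_expand[symmetric])
    then show ?thesis
      by (simp only: qmul.sum_left qmul.scaleR_left)
        (simp add: qmul.sum_right qmul.scaleR_right scaleR_sum_right mult.commute)
  qed
  then have "(\<Sum>h\<in>UNIV. qmul (dual_row b h) (f (b$h)))
      = (\<Sum>h\<in>UNIV. \<Sum>\<alpha>\<in>UNIV. \<Sum>\<beta>\<in>UNIV. (dual_row b h $ \<alpha> * b$h$\<beta>) *\<^sub>R qmul (?e \<alpha>) (f (?e \<beta>)))"
    by simp
  also have "\<dots> = (\<Sum>\<alpha>\<in>UNIV. \<Sum>h\<in>UNIV. \<Sum>\<beta>\<in>UNIV. (dual_row b h $ \<alpha> * b$h$\<beta>) *\<^sub>R qmul (?e \<alpha>) (f (?e \<beta>)))"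
    by (rule sum.swap)
  also have "\<dots> = (\<Sum>\<alpha>\<in>UNIV. \<Sum>\<beta>\<in>UNIV. \<Sum>h\<in>UNIV. (dual_row b h $ \<alpha> * b$h$\<beta>) *\<^sub>R qmul (?e \<alpha>) (f (?e \<beta>)))"
    by (intro sum.cong refl sum.swap)
  also have "\<dots> = (\<Sum>\<alpha>\<in>UNIV. \<Sum>\<beta>\<in>UNIV. (if \<alpha> = \<beta> then det b else 0) *\<^sub>R qmul (?e \<alpha>) (f (?e \<beta>)))"
    by (simp only: scaleR_sum_left[symmetric] coeff)
  also have "\<dots> = (\<Sum>\<alpha>\<in>UNIV. det b *\<^sub>R qmul (?e \<alpha>) (f (?e \<alpha>)))"
    by (simp add: if_distrib[of "\<lambda>c. c *\<^sub>R _"] cong: if_cong)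
  finally show ?thesis by (simp add: scaleR_sum_right)
qed

text \<open>Right multiplication by \<open>U\<close> acts on the dual basis as left multiplication by \<open>qcnj a\<close>, the
  adjoint of left multiplication by \<open>a\<close>.\<close>
lemma sum_dual_row_left_mult_matrix:
  assumes det: "det b \<noteq> 0" and U: "\<And>h. qmul a (b$h) = (\<Sum>j\<in>UNIV. of_int (U$h$j) *\<^sub>R b$j)"
  shows "(\<Sum>i\<in>UNIV. of_int (U$i$j) *\<^sub>R dual_row b i) = qmul (qcnj a) (dual_row b j)"
proof -
  let ?w = "(\<Sum>i\<in>UNIV. of_int (U$i$j) *\<^sub>R dual_row b i) - qmul (qcnj a) (dual_row b j)"
  have adjoint: "qmul (qcnj a) y \<bullet> x = y \<bullet> qmul a x" for x y
    by (simp add: inner_quat algebra_simps)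
  have "?w \<bullet> b$k = 0" for k
  proof -
    have "(\<Sum>i\<in>UNIV. of_int (U$i$j) *\<^sub>R dual_row b i) \<bullet> b$k = of_int (U$k$j) * det b"
      by (simp add: inner_sum_left dual_row_inner[OF det] if_distrib[of "\<lambda>c. _ * c"] cong: if_cong)
    moreover have "qmul (qcnj a) (dual_row b j) \<bullet> b$k = of_int (U$k$j) * det b"
      by (simp add: adjoint U inner_sum_right dual_row_inner[OF det] if_distrib[of "\<lambda>c. _ * c"] cong: if_cong)
    ultimately show ?thesis by (simp add: inner_diff_left)
  qed
  \<comment> \<open>\<open>b *v ?w\<close> lists the inner products of \<open>?w\<close> with the
    rows of b, and these rows span the space.\<close>
  then have "b *v ?w = 0"
    by (simp add: vec_eq_iff matrix_mult_dot inner_commute del: vector_minus_component)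
  moreover have "inj ((*v) b)"
    using det by (intro inj_matrix_vector_mult) (simp add: invertible_det_nz)
  ultimately have "?w = 0"
    using injD[of "(*v) b" ?w 0] by simp
  then show ?thesis by simp
qed

subsection \<open>The residue computation\<close>

text \<open>A finite-difference version of the Fueter operator, with the lattice basis as steps,
  applied to \<open>Gfun\<close>.\<close>

definition flux :: "real^4^4 \<Rightarrow> real^4 \<Rightarrow> real^4" where
  "flux b x = (\<Sum>h\<in>UNIV. qmul (dual_row b h) (Gfun (x + b$h) - Gfun x))"

lemma sum_dual_row_dG: "det b \<noteq> 0 \<Longrightarrow> (\<Sum>h\<in>UNIV. qmul (dual_row b h) (dG x (b$h))) = 0"
  by (simp add: sum_qmul_dual_row[OF _ linear_dG] dG_regular)

text \<open>Weighting the period series by the dual rows cancels all corrections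
  \<open>dG l\<close>, leaving a plain sum over the translated lattice.\<close>

lemma flux_has_sum:
  assumes det: "det b \<noteq> 0" and q: "q \<notin> zspan b"
  shows "((\<lambda>l. flux b (q + l)) has_sum
    (\<Sum>h\<in>UNIV. qmul (dual_row b h) (wzeta (zspan b) (q + b$h) - wzeta (zspan b) q))) (zspan b)"
proof -
  have eq: "(\<Sum>h\<in>UNIV. qmul (dual_row b h) (Gfun (q + l + b$h) - Gfun (q + l) - dG l (b$h))) = flux b (q + l)" for l
    using sum_dual_row_dG[OF det, of l] by (simp add: flux_def qmul.diff_right sum_subtractf)
  have "((\<lambda>l. \<Sum>h\<in>UNIV. qmul (dual_row b h) (Gfun (q + l + b$h) - Gfun (q + l) - dG l (b$h))) has_sum
    (\<Sum>h\<in>UNIV. qmul (dual_row b h) (wzeta (zspan b) (q + b$h) - wzeta (zspan b) q))) (zspan b)"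
    by (intro has_sum_sum has_sum_bounded_linear[OF qmul.bounded_linear_right]
        wzeta_period_has_sum[OF det q] zspan_row) auto
  then show ?thesis unfolding eq .
qed

text \<open>Merges the separate constants for each basis direction into one.\<close>

lemma qmul_sum_bound:
  fixes c :: "'i \<Rightarrow> real^4" and f :: "'i \<Rightarrow> 'k \<Rightarrow> real^4"
  assumes "finite I" "\<And>h. h \<in> I \<Longrightarrow> \<exists>C. \<forall>x. P x \<longrightarrow> norm (f h x) \<le> C * g x"
  shows "\<exists>C. \<forall>x. P x \<longrightarrow> norm (\<Sum>h\<in>I. qmul (c h) (f h x)) \<le> C * g x"
proof -
  obtain K where K: "K \<ge> 0" "\<And>p q. norm (qmul p q) \<le> norm p * norm q * K"
    using qmul.nonneg_bounded by blast
  have "\<forall>h\<in>I. \<exists>C. \<forall>x. P x \<longrightarrow> norm (f h x) \<le> C * g x"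
    using assms(2) by blast
  then obtain C where "\<forall>h\<in>I. \<forall>x. P x \<longrightarrow> norm (f h x) \<le> C h * g x"
    by (rule bchoice[THEN exE])
  then have C: "norm (f h x) \<le> C h * g x" if "h \<in> I" "P x" for h x
    using that by blast
  have "norm (\<Sum>h\<in>I. qmul (c h) (f h x)) \<le> (\<Sum>h\<in>I. norm (c h) * C h * K) * g x" if "P x" for x
  proof -
    have "norm (qmul (c h) (f h x)) \<le> norm (c h) * C h * K * g x" if "h \<in> I" for h
    proof -
      have "norm (c h) * norm (f h x) * K \<le> norm (c h) * (C h * g x) * K"
        using C[OF that \<open>P x\<close>] K(1) by (intro mult_right_mono mult_left_mono) auto
      then show ?thesis
        using K(2)[of "c h" "f h x"] by (simp add: mult_ac)
    qed
    then have "norm (\<Sum>h\<in>I. qmul (c h) (f h x)) \<le> (\<Sum>h\<in>I. norm (c h) * C h * K * g x)"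
      by (rule sum_norm_le)
    then show ?thesis by (simp add: sum_distrib_right)
  qed
  then show ?thesis by blast
qed

text \<open>Regularity allows \<open>dG x\<close>, taken at x itself, to be subtracted for free;
  each term then becomes a Taylor remainder.\<close>

lemma flux_bound:
  assumes det: "det b \<noteq> 0" and \<delta>: "\<delta> > 0"
  shows "\<exists>C. \<forall>x. \<delta> \<le> norm x \<and> (\<forall>h. \<delta> \<le> norm (x + b$h)) \<longrightarrow> norm (flux b x) \<le> C * (1 / norm x ^ 5)"
proof -
  have "\<exists>C. \<forall>x. \<delta> \<le> norm x \<and> (\<forall>h. \<delta> \<le> norm (x + b$h)) \<longrightarrow>
      norm (\<Sum>h\<in>UNIV. qmul (dual_row b h) (Gfun (x + b$h) - Gfun x - dG x (b$h))) \<le> C * (1 / norm x ^ 5)"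
    using Gfun_taylor[OF \<delta>] by (intro qmul_sum_bound) (auto, metis)
  moreover have "(\<Sum>h\<in>UNIV. qmul (dual_row b h) (Gfun (x + b$h) - Gfun x - dG x (b$h))) = flux b x" for x
    using sum_dual_row_dG[OF det, of x] by (simp add: flux_def qmul.diff_right sum_subtractf)
  ultimately show ?thesis by simp
qed

text \<open>\<open>Gfun\<close> alone has degree -3, too slow for absolute convergence; for fixed R
  the cutoff supplies two further orders of decay.\<close>

lemma cutoff_Gfun_summable:
  assumes det: "det b \<noteq> 0" and q: "q \<notin> zspan b" and \<mu>: "\<mu> \<in> zspan b" and R: "R > 0"
  shows "(\<lambda>l. cutoff ((norm (q + l) / R)\<^sup>2) *\<^sub>R Gfun (q + l + \<mu>)) summable_on zspan b"
proof -
  have nz: "q + l \<noteq> 0" if "l \<in> zspan b" for l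
    using zspan_uminus[OF that] q by (metis add_eq_0_iff2)
  obtain \<delta> where \<delta>: "\<delta> > 0" "\<And>l. l \<in> zspan b \<Longrightarrow> \<delta> \<le> norm (q + l)"
    using lattice_separated[OF det, of q] nz by metis
  define M where "M = 1 + norm \<mu> / \<delta>"
  have M: "M > 0" using \<delta> by (simp add: M_def add_pos_nonneg)
  have "(\<lambda>l. norm (cutoff ((norm (q + l) / R)\<^sup>2) *\<^sub>R Gfun (q + l + \<mu>))) summable_on zspan b"
  proof (rule Infinite_Sum.abs_summable_on_comparison_test')
    show "(\<lambda>l. 3 * R\<^sup>2 * M ^ 3 * (1 / norm (q + l) ^ 5)) summable_on zspan b"
      by (intro summable_on_cmult_right summable_on_zspan det)
    fix l assume l: "l \<in> zspan b"
    define a where "a = norm (q + l)"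
    define s where "s = norm (q + l + \<mu>)"
    have a: "a > 0" using nz[OF l] by (simp add: a_def)
    have "\<delta> \<le> s" using \<delta>(2)[OF zspan_add[OF l \<mu>]] by (simp add: s_def add.assoc)
    then have s: "s > 0" using \<delta>(1) by linarith
    have "a \<le> M * s"
      unfolding a_def s_def M_def using \<delta>(1) \<open>\<delta> \<le> s\<close>
      by (intro norm_comparable_translate) (simp_all add: s_def)
    then have "a ^ 3 \<le> (M * s) ^ 3" using a by (intro power_mono) auto
    then have "1 / s ^ 3 \<le> M ^ 3 / a ^ 3"
      using a s by (simp add: field_simps power_mult_distrib)
    moreover have "cutoff ((a / R)\<^sup>2) \<le> 3 * R\<^sup>2 / a\<^sup>2"
      using cutoff_bounds(3)[of "(a / R)\<^sup>2"] a R by (simp add: field_simps)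
    ultimately have "cutoff ((a / R)\<^sup>2) * (1 / s ^ 3) \<le> (3 * R\<^sup>2 / a\<^sup>2) * (M ^ 3 / a ^ 3)"
      using s by (intro mult_mono) auto
    also have "\<dots> = 3 * R\<^sup>2 * M ^ 3 * (1 / a ^ 5)"
      using a by (simp add: field_simps eval_nat_numeral)
    finally show "norm (cutoff ((norm (q + l) / R)\<^sup>2) *\<^sub>R Gfun (q + l + \<mu>)) \<le> 3 * R\<^sup>2 * M ^ 3 * (1 / norm (q + l) ^ 5)"
      using cutoff_bounds(1)[of "(a / R)\<^sup>2"] by (simp add: norm_Gfun a_def s_def)
  qed
  then show ?thesis by (rule abs_summable_summable)
qed

definition cutoff_flux :: "real^4^4 \<Rightarrow> real \<Rightarrow> real^4 \<Rightarrow> real^4" where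
  "cutoff_flux b R x = (\<Sum>h\<in>UNIV. qmul (dual_row b h)
    ((cutoff ((norm (x - b$h) / R)\<^sup>2) - cutoff ((norm x / R)\<^sup>2)) *\<^sub>R Gfun x))"

text \<open>Under the cutoff the two halves of each difference converge separately, so one of them
  may be reindexed by a lattice translation.\<close>

lemma summation_by_parts:
  assumes det: "det b \<noteq> 0" and q: "q \<notin> zspan b" and R: "R > 0"
  obtains S where "((\<lambda>l. cutoff ((norm (q + l) / R)\<^sup>2) *\<^sub>R flux b (q + l)) has_sum S) (zspan b)"
    "((\<lambda>l. cutoff_flux b R (q + l)) has_sum S) (zspan b)"
proof -
  let ?L = "zspan b"
  define c where "c x = cutoff ((norm x / R)\<^sup>2)" for x :: "real^4"
  define P where "P \<mu> l = c (q + l) *\<^sub>R Gfun (q + l + \<mu>)" for \<mu> l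
  have P: "(P \<mu> has_sum infsum (P \<mu>) ?L) ?L" if "\<mu> \<in> ?L" for \<mu>
    unfolding P_def c_def by (intro has_sum_infsum cutoff_Gfun_summable det q R that)
  have shift: "((\<lambda>l. c (q + l - \<mu>) *\<^sub>R Gfun (q + l)) has_sum infsum (P \<mu>) ?L) ?L" if "\<mu> \<in> ?L" for \<mu>
  proof -
    have "((\<lambda>l. P \<mu> (l + - \<mu>)) has_sum infsum (P \<mu>) ?L) ?L"
      by (subst has_sum_reindex_bij_betw[OF zspan_translate_bij]) (use that zspan_uminus P in auto)
    then show ?thesis by (simp add: P_def algebra_simps)
  qed
  let ?S = "\<Sum>h\<in>UNIV. qmul (dual_row b h) (infsum (P (b$h)) ?L - infsum (P 0) ?L)"
  have "((\<lambda>l. \<Sum>h\<in>UNIV. qmul (dual_row b h) (P (b$h) l - P 0 l)) has_sum ?S) ?L"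
    by (intro has_sum_sum has_sum_bounded_linear[OF qmul.bounded_linear_right] has_sum_diff P zspan_row zspan_0) auto
  moreover have "(\<Sum>h\<in>UNIV. qmul (dual_row b h) (P (b$h) l - P 0 l)) = c (q + l) *\<^sub>R flux b (q + l)" for l
    by (simp add: P_def flux_def scaleR_sum_right qmul.scaleR_right[symmetric] scaleR_diff_right)
  ultimately have 1: "((\<lambda>l. c (q + l) *\<^sub>R flux b (q + l)) has_sum ?S) ?L" by simp
  \<comment> \<open>The form \<open>q + l - 0\<close> makes the unshifted piece the instance
    \<open>\<mu> = 0\<close> of \<open>shift\<close>.\<close>
  have "((\<lambda>l. \<Sum>h\<in>UNIV. qmul (dual_row b h) (c (q + l - b$h) *\<^sub>R Gfun (q + l) - c (q + l - 0) *\<^sub>R Gfun (q + l)))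
      has_sum ?S) ?L"
    by (intro has_sum_sum has_sum_bounded_linear[OF qmul.bounded_linear_right] has_sum_diff shift zspan_row zspan_0) auto
  then have 2: "((\<lambda>l. cutoff_flux b R (q + l)) has_sum ?S) ?L"
    by (simp add: cutoff_flux_def c_def scaleR_diff_left)
  show ?thesis
    using that[OF 1[unfolded c_def] 2] .
qed

text \<open>The linear part of the expansion contracts to a multiple of
  \<open>qmul x (Gfun x)\<close>, the inverse squared norm of x. The squared norm in k cancels it
  and leaves the Gaussian.\<close>

lemma cutoff_flux_eq:
  assumes det: "det b \<noteq> 0" and x: "x \<noteq> 0" and R: "R > 0"
  shows "cutoff_flux b R x = (2 * det b / R ^ 4 * exp (- (norm x / R)\<^sup>2)) *\<^sub>R qone
    + (\<Sum>h\<in>UNIV. qmul (dual_row b h) (cutoff_error R x (- b$h) *\<^sub>R Gfun x))"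
proof -
  define k where "k = 2 / R\<^sup>2 * ((norm x / R)\<^sup>2 * exp (- (norm x / R)\<^sup>2))"
  have lin: "linear (\<lambda>v. (k * (x \<bullet> v)) *\<^sub>R Gfun x)"
    by (auto intro!: linearI simp: inner_add_right algebra_simps)
  have "(\<Sum>h\<in>UNIV. qmul (dual_row b h) ((k * (x \<bullet> b$h)) *\<^sub>R Gfun x))
      = det b *\<^sub>R (\<Sum>\<alpha>\<in>UNIV. qmul (axis \<alpha> 1) ((k * (x \<bullet> axis \<alpha> 1)) *\<^sub>R Gfun x))"
    by (rule sum_qmul_dual_row[OF det lin])
  also have "(\<Sum>\<alpha>\<in>UNIV. qmul (axis \<alpha> 1) ((k * (x \<bullet> axis \<alpha> 1)) *\<^sub>R Gfun x))
      = k *\<^sub>R qmul (\<Sum>\<alpha>\<in>UNIV. x$\<alpha> *\<^sub>R axis \<alpha> 1) (Gfun x)"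
    by (simp add: qmul.sum_left qmul.scaleR_left qmul.scaleR_right scaleR_sum_right inner_axis)
  also have "(\<Sum>\<alpha>\<in>UNIV. x$\<alpha> *\<^sub>R axis \<alpha> 1) = x"
    by (simp add: vec_eq_iff axis_def if_distrib cong: if_cong)
  also have "qmul x (Gfun x) = (1 / (norm x)\<^sup>2) *\<^sub>R qone"
    using x by (simp add: Gfun_def qmul.scaleR_right qmul_qcnj field_simps eval_nat_numeral)
  also have "det b *\<^sub>R k *\<^sub>R (1 / (norm x)\<^sup>2) *\<^sub>R qone = (2 * det b / R ^ 4 * exp (- (norm x / R)\<^sup>2)) *\<^sub>R qone"
    using x R by (simp add: k_def field_simps eval_nat_numeral)
  finally have main: "(\<Sum>h\<in>UNIV. qmul (dual_row b h) ((k * (x \<bullet> b$h)) *\<^sub>R Gfun x))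
      = (2 * det b / R ^ 4 * exp (- (norm x / R)\<^sup>2)) *\<^sub>R qone" .
  have "cutoff ((norm (x - v) / R)\<^sup>2) - cutoff ((norm x / R)\<^sup>2) = k * (x \<bullet> v) + cutoff_error R x (- v)" for v
    by (simp add: cutoff_error_def k_def)
  then have "cutoff_flux b R x = (\<Sum>h\<in>UNIV. qmul (dual_row b h) ((k * (x \<bullet> b$h)) *\<^sub>R Gfun x))
      + (\<Sum>h\<in>UNIV. qmul (dual_row b h) (cutoff_error R x (- b$h) *\<^sub>R Gfun x))"
    by (simp add: cutoff_flux_def scaleR_add_left qmul.add_right sum.distrib)
  then show ?thesis by (simp only: main)
qed

section \<open>Comparison of two limits of the cutoff sum\<close>

theorem legendre_relation:
  assumes det: "det b > 0" and q: "q \<notin> zspan b"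
  shows "(\<Sum>h\<in>UNIV. qmul (dual_row b h) (wzeta (zspan b) (q + b$h) - wzeta (zspan b) q)) = (2 * pi\<^sup>2) *\<^sub>R qone"
    (is "?W = _")
proof -
  let ?L = "zspan b"
  have det0: "det b \<noteq> 0" using det by simp
  have nz: "q + l \<noteq> 0" if "l \<in> ?L" for l
    using zspan_uminus[OF that] q by (metis add_eq_0_iff2)
  obtain \<delta> where \<delta>: "\<delta> > 0" "\<And>l. l \<in> ?L \<Longrightarrow> \<delta> \<le> norm (q + l)"
    using lattice_separated[OF det0, of q] nz by metis
  have sep: "\<delta> \<le> norm (q + l)" "\<delta> \<le> norm (q + l + b$h)" "\<delta> \<le> norm (q + l + - b$h)" if "l \<in> ?L" for l h
    using \<delta>(2)[OF that] \<delta>(2)[OF zspan_add[OF that zspan_row]]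
      \<delta>(2)[OF zspan_add[OF that zspan_uminus[OF zspan_row]]] by (simp_all add: algebra_simps)
  define R where "R k = real (Suc k)" for k
  have R: "R k > 0" for k by (simp add: R_def)
  define c where "c k x = cutoff ((norm x / R k)\<^sup>2)" for k and x :: "real^4"
  define err where "err k x = (\<Sum>h\<in>UNIV. qmul (dual_row b h) (cutoff_error (R k) x (- b$h) *\<^sub>R Gfun x))" for k x
  define gauss where "gauss k l = exp (- (norm (q + l) / R k)\<^sup>2)" for k l

  obtain C where C: "\<And>x. \<delta> \<le> norm x \<Longrightarrow> (\<And>h. \<delta> \<le> norm (x + b$h)) \<Longrightarrow> norm (flux b x) \<le> C * (1 / norm x ^ 5)"
    using flux_bound[OF det0 \<delta>(1)] by blast
  \<comment> \<open>The flux is absolutely summable and the cutoff lies between 0 and 1, so the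
    cutoff can be removed in the limit.\<close>
  have lim_flux: "(\<lambda>k. \<Sum>\<^sub>\<infinity>l\<in>?L. c k (q + l) *\<^sub>R flux b (q + l)) \<longlonglongrightarrow> ?W"
  proof -
    have "(\<lambda>k. \<Sum>\<^sub>\<infinity>l\<in>?L. c k (q + l) *\<^sub>R flux b (q + l)) \<longlonglongrightarrow> (\<Sum>\<^sub>\<infinity>l\<in>?L. flux b (q + l))"
    proof (rule infsum_tannery)
      show "(\<lambda>l. C * (1 / norm (q + l) ^ 5)) summable_on ?L"
        by (intro summable_on_cmult_right summable_on_zspan det0)
      fix k l assume l: "l \<in> ?L"
      have "norm (c k (q + l) *\<^sub>R flux b (q + l)) \<le> 1 * norm (flux b (q + l))"
        unfolding norm_scaleR c_def using cutoff_bounds(1,2)[of "(norm (q + l) / R k)\<^sup>2"]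
        by (intro mult_right_mono) auto
      also have "\<dots> \<le> C * (1 / norm (q + l) ^ 5)"
        using C[of "q + l"] sep[OF l] by simp
      finally show "norm (c k (q + l) *\<^sub>R flux b (q + l)) \<le> C * (1 / norm (q + l) ^ 5)" .
      have "(\<lambda>k. c k (q + l) *\<^sub>R flux b (q + l)) \<longlonglongrightarrow> 1 *\<^sub>R flux b (q + l)"
        unfolding c_def R_def by (intro tendsto_scaleR tendsto_cutoff_dilate tendsto_const)
      then show "(\<lambda>k. c k (q + l) *\<^sub>R flux b (q + l)) \<longlonglongrightarrow> flux b (q + l)" by simp
    qed
    then show ?thesis
      using infsumI[OF flux_has_sum[OF det0 q]] by simp
  qed

  have "\<exists>C. \<forall>k x. \<delta> \<le> norm x \<and> (\<forall>h. \<delta> \<le> norm (x + - b$h)) \<longrightarrow>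
      norm (\<Sum>h\<in>UNIV. qmul (dual_row b h) (cutoff_error (R k) x (- b$h) *\<^sub>R Gfun x)) \<le> C * (1 / norm x ^ 5)"
  proof -
    \<comment> \<open>Taking the pair of k and x as the variable makes the constant from
      \<open>qmul_sum_bound\<close> uniform in k.\<close>
    have "\<exists>C. \<forall>p. \<delta> \<le> norm (snd p) \<and> (\<forall>h. \<delta> \<le> norm (snd p + - b$h)) \<longrightarrow>
      norm (\<Sum>h\<in>UNIV. qmul (dual_row b h) (cutoff_error (R (fst p)) (snd p) (- b$h) *\<^sub>R Gfun (snd p)))
        \<le> C * (1 / norm (snd p) ^ 5)"
    proof (rule qmul_sum_bound)
      fix h :: 4
      obtain C where C: "\<And>R x. 0 < R \<Longrightarrow> \<delta> \<le> norm x \<Longrightarrow> \<delta> \<le> norm (x + - b$h) \<Longrightarrow>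
          \<bar>cutoff_error R x (- b$h)\<bar> \<le> C / (norm x)\<^sup>2"
        using cutoff_error_bound[OF \<delta>(1)] by blast
      have "norm (cutoff_error (R k) x (- b$h) *\<^sub>R Gfun x) \<le> C * (1 / norm x ^ 5)"
        if "\<delta> \<le> norm x" "\<delta> \<le> norm (x + - b$h)" for k x
      proof -
        have "\<bar>cutoff_error (R k) x (- b$h)\<bar> * (1 / norm x ^ 3) \<le> C / (norm x)\<^sup>2 * (1 / norm x ^ 3)"
          by (intro mult_right_mono C R that) simp
        then show ?thesis
          by (simp add: norm_Gfun eval_nat_numeral mult_ac)
      qed
      then show "\<exists>C. \<forall>p. \<delta> \<le> norm (snd p) \<and> (\<forall>h. \<delta> \<le> norm (snd p + - b$h)) \<longrightarrow>
          norm (cutoff_error (R (fst p)) (snd p) (- b$h) *\<^sub>R Gfun (snd p)) \<le> C * (1 / norm (snd p) ^ 5)"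
        by blast
    qed simp
    then show ?thesis unfolding split_paired_All fst_conv snd_conv by blast
  qed
  then obtain E where E: "\<And>k x. \<delta> \<le> norm x \<Longrightarrow> (\<And>h. \<delta> \<le> norm (x + - b$h)) \<Longrightarrow> norm (err k x) \<le> E * (1 / norm x ^ 5)"
    unfolding err_def by blast
  have err_bound: "norm (err k (q + l)) \<le> E * (1 / norm (q + l) ^ 5)" if "l \<in> ?L" for k l
    using E sep[OF that] by blast
  have sumE: "(\<lambda>l. E * (1 / norm (q + l) ^ 5)) summable_on ?L"
    by (intro summable_on_cmult_right summable_on_zspan det0)
  have lim_err: "(\<lambda>k. \<Sum>\<^sub>\<infinity>l\<in>?L. err k (q + l)) \<longlonglongrightarrow> 0"
  proof -
    have "(\<lambda>k. \<Sum>\<^sub>\<infinity>l\<in>?L. err k (q + l)) \<longlonglongrightarrow> (\<Sum>\<^sub>\<infinity>l\<in>?L. 0)"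
    proof (rule infsum_tannery[OF err_bound sumE])
      fix l
      have "(\<lambda>k. err k (q + l)) \<longlonglongrightarrow> (\<Sum>h\<in>UNIV. qmul (dual_row b h) (0 *\<^sub>R Gfun (q + l)))"
        unfolding err_def R_def
        by (intro tendsto_sum qmul.tendsto tendsto_scaleR tendsto_cutoff_error tendsto_const)
      then show "(\<lambda>k. err k (q + l)) \<longlonglongrightarrow> 0" by (simp add: qmul.zero_right)
    qed
    then show ?thesis by simp
  qed

  have decomp: "(\<Sum>\<^sub>\<infinity>l\<in>?L. c k (q + l) *\<^sub>R flux b (q + l))
      = (2 * det b * ((\<Sum>\<^sub>\<infinity>l\<in>?L. gauss k l) / R k ^ 4)) *\<^sub>R qone + (\<Sum>\<^sub>\<infinity>l\<in>?L. err k (q + l))" for k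
  proof -
    obtain S where S: "((\<lambda>l. c k (q + l) *\<^sub>R flux b (q + l)) has_sum S) ?L"
      "((\<lambda>l. cutoff_flux b (R k) (q + l)) has_sum S) ?L"
      unfolding c_def by (rule summation_by_parts[OF det0 q R])
    have "(\<lambda>l. err k (q + l)) summable_on ?L"
      by (rule abs_summable_summable[OF Infinite_Sum.abs_summable_on_comparison_test'[OF sumE err_bound]])
    then have "((\<lambda>l. cutoff_flux b (R k) (q + l) - err k (q + l)) has_sum (S - (\<Sum>\<^sub>\<infinity>l\<in>?L. err k (q + l)))) ?L"
      using S(2) by (intro has_sum_diff has_sum_infsum)
    moreover have "cutoff_flux b (R k) (q + l) - err k (q + l) = (2 * det b / R k ^ 4 * gauss k l) *\<^sub>R qone"
      if "l \<in> ?L" for l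
      using cutoff_flux_eq[OF det0 nz[OF that] R] by (simp add: err_def gauss_def)
    ultimately have main: "((\<lambda>l. (2 * det b / R k ^ 4 * gauss k l) *\<^sub>R qone) has_sum (S - (\<Sum>\<^sub>\<infinity>l\<in>?L. err k (q + l)))) ?L"
      by (metis (no_types, lifting) has_sum_cong)
    \<comment> \<open>The real component recovers a scalar series and its summability, after which
      \<open>qone\<close> can be factored out of the sum.\<close>
    have "((\<lambda>l. 2 * det b / R k ^ 4 * gauss k l) has_sum ((S - (\<Sum>\<^sub>\<infinity>l\<in>?L. err k (q + l))) $ 0)) ?L"
      using has_sum_bounded_linear[OF bounded_linear_vec_nth[of 0] main] by simp
    then have "(\<lambda>l. 2 * det b / R k ^ 4 * gauss k l) summable_on ?L"
      by (auto simp: summable_on_def)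
    then have "(\<Sum>\<^sub>\<infinity>l\<in>?L. (2 * det b / R k ^ 4 * gauss k l) *\<^sub>R qone)
        = (2 * det b / R k ^ 4 * (\<Sum>\<^sub>\<infinity>l\<in>?L. gauss k l)) *\<^sub>R qone"
      by (subst infsum_scaleR_left, assumption) (subst infsum_cmult_right', rule refl)
    then show ?thesis
      using infsumI[OF main] infsumI[OF S(1)] by (simp add: algebra_simps)
  qed
  have "(\<lambda>k. (\<Sum>\<^sub>\<infinity>l\<in>?L. gauss k l) / R k ^ 4) \<longlonglongrightarrow> pi\<^sup>2 / \<bar>det b\<bar>"
    unfolding gauss_def R_def by (rule gaussian_lattice_sum_tendsto[OF det0])
  then have "(\<lambda>k. \<Sum>\<^sub>\<infinity>l\<in>?L. c k (q + l) *\<^sub>R flux b (q + l)) \<longlonglongrightarrow> (2 * det b * (pi\<^sup>2 / \<bar>det b\<bar>)) *\<^sub>R qone + 0"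
    unfolding decomp using lim_err by (intro tendsto_add tendsto_scaleR tendsto_mult tendsto_const)
  then have "?W = (2 * det b * (pi\<^sup>2 / \<bar>det b\<bar>)) *\<^sub>R qone + 0"
    using lim_flux LIMSEQ_unique by blast
  then show ?thesis using det by simp
qed

section \<open>Reduction of general a to a = 1\<close>

theorem mainTheorem16:
  fixes D Ord :: "(real^4) set" and Lam :: "real^4^4"
  assumes "quat_division_algebra D"
    and "maximal_order D Ord"
    and "zspan Lam \<subseteq> D"
    and "\<forall>a\<in>Ord. \<forall>x\<in>zspan Lam. qmul a x \<in> zspan Lam"
    and "det Lam > 0"
  shows "\<forall>a\<in>Ord. \<forall>U :: int^4^4. \<forall>q. q \<notin> zspan Lam \<longrightarrow>
           (\<forall>h. qmul a (Lam$h) = (\<Sum>j\<in>UNIV. of_int (U$h$j) *\<^sub>R Lam$j)) \<longrightarrow>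
           (\<Sum>i\<in>UNIV. \<Sum>j\<in>UNIV.
              qmul (((det Lam) *\<^sub>R transpose (matrix_inv Lam)) $ i)
                   (of_int (U$i$j) *\<^sub>R (wzeta (zspan Lam) (q + Lam$j) - wzeta (zspan Lam) q)))
           = (2 * pi\<^sup>2) *\<^sub>R qcnj a"
proof (intro ballI allI impI)
  fix a :: "real^4" and U :: "int^4^4" and q
  assume q: "q \<notin> zspan Lam"
    and U: "\<forall>h. qmul a (Lam$h) = (\<Sum>j\<in>UNIV. of_int (U$h$j) *\<^sub>R Lam$j)"
  define \<eta> where "\<eta> j = wzeta (zspan Lam) (q + Lam$j) - wzeta (zspan Lam) q" for j
  have det: "det Lam \<noteq> 0" using assms(5) by simp
  \<comment> \<open>The integer entries are real scalars, so they pass across the noncommutative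
    product onto the dual rows, where the sum over i produces left multiplication by
    \<open>qcnj a\<close>.\<close>
  have "(\<Sum>i\<in>UNIV. \<Sum>j\<in>UNIV. qmul (dual_row Lam i) (of_int (U$i$j) *\<^sub>R \<eta> j))
      = (\<Sum>j\<in>UNIV. \<Sum>i\<in>UNIV. qmul (of_int (U$i$j) *\<^sub>R dual_row Lam i) (\<eta> j))"
    by (subst sum.swap) (simp add: qmul.scaleR_left qmul.scaleR_right)
  also have "\<dots> = (\<Sum>j\<in>UNIV. qmul (qmul (qcnj a) (dual_row Lam j)) (\<eta> j))"
    by (simp only: qmul.sum_left[symmetric] sum_dual_row_left_mult_matrix[OF det U[rule_format]])
  also have "\<dots> = qmul (qcnj a) (\<Sum>j\<in>UNIV. qmul (dual_row Lam j) (\<eta> j))"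
    by (simp add: qmul_assoc qmul.sum_right)
  also have "\<dots> = (2 * pi\<^sup>2) *\<^sub>R qcnj a"
    unfolding \<eta>_def legendre_relation[OF assms(5) q] by (simp add: qmul.scaleR_right)
  finally show "(\<Sum>i\<in>UNIV. \<Sum>j\<in>UNIV.
      qmul (((det Lam) *\<^sub>R transpose (matrix_inv Lam)) $ i)
        (of_int (U$i$j) *\<^sub>R (wzeta (zspan Lam) (q + Lam$j) - wzeta (zspan Lam) q)))
      = (2 * pi\<^sup>2) *\<^sub>R qcnj a"
    unfolding \<eta>_def dual_row_def .
qed

end
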